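(* Let $\|w\|_{L^\infty(\Omega)}\le\bar c_0<\bar v/\sqrt5$, $\|w_x\|_{L^\infty(\Omega)}\le\bar c_1$, $\|w_{xx}\|_{L^\infty(\Omega)}\le\bar c_2$, $\|w_{xxx}\|_{L^\infty(\Omega)}\le\bar c_3$, and $\tilde L:=\|x_D-x_O\|$. Let $\chi^*=(z^*,\lambda^* )$, $z^*=(L^*,\xi^* )$, be a globally optimal solution of problem (P) with its Lagrange multiplier $\lambda^*=0$, satisfying the first order necessary conditions and the second order sufficient conditions with constant $\underline{\mathcal B}>0$. Then there is $0<R<\min\{\underline{\mathcal B}/(2\bar\Gamma),\ \underline{\mathcal B}/40,\ \tilde L/2\}$ such that $$\mathcal L_{zz}(\chi)[\delta z]^2\ge\frac{\underline{\mathcal B}}{4}\|\delta z\|_{Z^2}^2$$ for any $\chi=(L,\xi,\lambda)\in\mathcal N_R(\chi^* )$ and any $\delta z=(\delta L,\delta\xi)\in\delta Z$ such that $\xi_\tau^T\delta\xi_\tau=L\,\delta L$ almost everywhere.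
   Context: Fix $\bar v>0$, $x_O\neq x_D\in\mathbb R^2$, and $w\in C^3(\mathbb R^2,\mathbb R^2)$ with $\|w(x)\|<\bar v$; $\Omega\subset\mathbb R^2$ is an ellipse with foci $x_O,x_D$ containing every globally optimal trajectory; $\|g\|_{L^\infty(D)}=\inf\{C\ge0:\|g(x)\|\le C\text{ a.e. on }D\}$ with Euclidean/operator norms. $f(x,p)=\frac{-p^Tw(x)+\sqrt{(p^Tw(x))^2+(\bar v^2-w(x)^Tw(x))p^Tp}}{\bar v^2-w(x)^Tw(x)}$; $X=\{\xi\in W^{1,\infty}(]0,1[,\mathbb R^2):\xi(0)=x_O,\xi(1)=x_D\}$, $\delta X=W^{1,\infty}_0(]0,1[,\mathbb R^2)$; $T(\xi)=\int_0^1f(\xi,\xi_\tau)d\tau$. Problem (P): minimize $T(\xi)$ over $\xi\in X,L\in\mathbb R$ s.t. $\|\xi_\tau\|^2=L^2$ a.e. $z=(L,\xi)\in Z=\mathbb R\times X$, $\delta Z=\mathbb R\times\delta X$, $h(z)=\xi_\tau^T\xi_\tau-L^2$. Norms: $\|z\|_{Z^\infty}=|L|+\|\xi\|_{L^\infty}+\|\xi_\tau\|_{L^\infty}$, $\|z\|_{Z^2}=|L|+\|\xi\|_{L^2}+\|\xi_\tau\|_{L^2}$, $\|(z,\lambda)\|_{Y^\infty}=\|z\|_{Z^\infty}+\|\lambda\|_{L^\infty}$; $\mathcal N_R(\chi^* )=\{\chi:\|\chi-\chi^*\|_{Y^\infty}\le R\}$. Lagrangian $\mathcal L(z,\lambda)=T(\xi)+\int_0^1\lambda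 h(z)d\tau$, so $\mathcal L_{zz}(\chi)[\delta z]^2=T''(\xi)[\delta\xi]^2+2\int_0^1\lambda(\delta\xi_\tau^T\delta\xi_\tau-\delta L^2)d\tau$. First order conditions: $\mathcal L'(z^*,\lambda^* )=0$. Second order sufficient conditions with $\underline{\mathcal B}$: there is $\kappa>0$ with $\inf_{0\ne\delta\lambda\in L^2}\sup_{\delta z\in\delta Z}\frac{\int_0^1\delta\lambda(2\xi_\tau^{*T}\delta\xi_\tau-2L^*\delta L)d\tau}{\|\delta\lambda\|_{L^2}\|\delta z\|_{Z^2}}\ge\kappa$, and $T''(\xi^* )[\delta\xi]^2\ge\underline{\mathcal B}\|\delta z\|^2_{Z^2}$ for all $\delta z\in\delta Z$ with $\delta\xi_\tau^T\xi^*_\tau=\delta L\,L^*$ a.e. The constant $\bar\Gamma=\bar\Gamma(R)$: with $\underline v^2=\bar v^2-\bar c_0^2$, $\bar\gamma_0=\frac{2}{\underline v^4}(37\bar c_1^3+21\bar c_1\bar c_2\underline v+2\bar c_3\underline v^2)$, $\bar\gamma_1=\frac{29\bar c_1^2+7\underline v\bar c_2}{\underline v^3}$, $\bar\gamma_2=\frac{57\bar c_1^2+13\underline v\bar c_2}{\underline v^3}$, $\bar\gamma_3=\frac{40\bar c_1}{\underline v^2}$, $\bar\gamma_4=\frac{20\bar c_1}{\underline v^2}$, $\bar\gamma_5=\frac{18}{\underline v}$, set $\bar\Gamma=\max\{(\frac{\bar v+\bar c_0}{\bar v-\bar c_0}\tilde L+R)\bar\gamma_0+\frac{\bar\gamma_2}2,\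 \frac{\bar\gamma_4}{\tilde L-R}+\frac{\bar\gamma_2}2,\ \bar\gamma_1+\frac{\bar\gamma_3}{2(\tilde L-R)},\ \frac{\bar\gamma_3}{2(\tilde L-R)}+\frac{\bar\gamma_5}{(\tilde L-R)^2}\}$. *)

theory Defs
  imports "HOL-Analysis.Analysis"
begin

type_synonym pt = "real^2"

definition ae01 :: "(real \<Rightarrow> bool) \<Rightarrow> bool" where
  "ae01 P \<longleftrightarrow> (AE t in lebesgue_on {0..1::real}. P t)"

definition Linf :: "(real \<Rightarrow> 'a::real_normed_vector) \<Rightarrow> real" where
  "Linf g = Inf {C. C \<ge> 0 \<and> ae01 (\<lambda>t. norm (g t) \<le> C)}"

definition L2norm :: "(real \<Rightarrow> 'a::real_normed_vector) \<Rightarrow> real" where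
  "L2norm g = sqrt (integral\<^sup>L (lebesgue_on {0..1::real}) (\<lambda>t. (norm (g t))\<^sup>2))"

definition Linf_space :: "(real \<Rightarrow> 'a::real_normed_vector) \<Rightarrow> bool" where
  "Linf_space g \<longleftrightarrow> g \<in> borel_measurable (lebesgue_on {0..1::real}) \<and>
     (\<exists>C. ae01 (\<lambda>t. norm (g t) \<le> C))"

definition L2_space :: "(real \<Rightarrow> 'a::real_normed_vector) \<Rightarrow> bool" where
  "L2_space g \<longleftrightarrow> g \<in> borel_measurable (lebesgue_on {0..1::real}) \<and>
     integrable (lebesgue_on {0..1::real}) (\<lambda>t. (norm (g t))\<^sup>2)"

text \<open>\<open>W1inf \<xi> \<xi>'\<close>: \<open>\<xi>\<close> (continuous representative on [0,1]) lies in
  W^{1,\<infinity>}(]0,1[,R^2) and \<open>\<xi>'\<close> is (a representative of) its weak derivative \<open>\<xi>_\<tau>\<close>.\<close>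
definition W1inf :: "(real \<Rightarrow> pt) \<Rightarrow> (real \<Rightarrow> pt) \<Rightarrow> bool" where
  "W1inf \<xi> \<xi>' \<longleftrightarrow> Linf_space \<xi>' \<and> (\<forall>t\<in>{0..1}. (\<xi>' has_integral (\<xi> t - \<xi> 0)) {0..t})"

definition inX :: "pt \<Rightarrow> pt \<Rightarrow> (real \<Rightarrow> pt) \<Rightarrow> (real \<Rightarrow> pt) \<Rightarrow> bool" where
  "inX xO xD \<xi> \<xi>' \<longleftrightarrow> W1inf \<xi> \<xi>' \<and> \<xi> 0 = xO \<and> \<xi> 1 = xD"

definition dZset :: "(real \<times> (real \<Rightarrow> pt) \<times> (real \<Rightarrow> pt)) set" where
  "dZset = {(dL, d\<xi>, d\<xi>'). W1inf d\<xi> d\<xi>' \<and> d\<xi> 0 = 0 \<and> d\<xi> 1 = 0}"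

definition Z2norm :: "real \<Rightarrow> (real \<Rightarrow> pt) \<Rightarrow> (real \<Rightarrow> pt) \<Rightarrow> real" where
  "Z2norm dL d\<xi> d\<xi>' = \<bar>dL\<bar> + L2norm d\<xi> + L2norm d\<xi>'"

definition fcost :: "real \<Rightarrow> (pt \<Rightarrow> pt) \<Rightarrow> pt \<Rightarrow> pt \<Rightarrow> real" where
  "fcost vb w x p =
     (- (p \<bullet> w x) + sqrt ((p \<bullet> w x)\<^sup>2 + (vb\<^sup>2 - w x \<bullet> w x) * (p \<bullet> p))) / (vb\<^sup>2 - w x \<bullet> w x)"

definition Tfun :: "real \<Rightarrow> (pt \<Rightarrow> pt) \<Rightarrow> (real \<Rightarrow> pt) \<Rightarrow> (real \<Rightarrow> pt) \<Rightarrow> real" where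
  "Tfun vb w \<xi> \<xi>' = integral\<^sup>L (lebesgue_on {0..1::real}) (\<lambda>t. fcost vb w (\<xi> t) (\<xi>' t))"

definition T2 :: "real \<Rightarrow> (pt \<Rightarrow> pt) \<Rightarrow> (real \<Rightarrow> pt) \<Rightarrow> (real \<Rightarrow> pt)
                    \<Rightarrow> (real \<Rightarrow> pt) \<Rightarrow> (real \<Rightarrow> pt) \<Rightarrow> real" where
  "T2 vb w \<xi> \<xi>' d\<xi> d\<xi>' =
     deriv (deriv (\<lambda>s. Tfun vb w (\<lambda>t. \<xi> t + s *\<^sub>R d\<xi> t) (\<lambda>t. \<xi>' t + s *\<^sub>R d\<xi>' t))) 0"

definition feasible :: "real \<Rightarrow> (pt \<Rightarrow> pt) \<Rightarrow> pt \<Rightarrow> pt \<Rightarrow> real \<Rightarrow> (real \<Rightarrow> pt) \<Rightarrow> (real \<Rightarrow> pt) \<Rightarrow> bool" where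
  "feasible vb w xO xD L \<xi> \<xi>' \<longleftrightarrow> inX xO xD \<xi> \<xi>' \<and> ae01 (\<lambda>t. (norm (\<xi>' t))\<^sup>2 = L\<^sup>2)"

definition glob_opt :: "real \<Rightarrow> (pt \<Rightarrow> pt) \<Rightarrow> pt \<Rightarrow> pt \<Rightarrow> real \<Rightarrow> (real \<Rightarrow> pt) \<Rightarrow> (real \<Rightarrow> pt) \<Rightarrow> bool" where
  "glob_opt vb w xO xD L \<xi> \<xi>' \<longleftrightarrow> feasible vb w xO xD L \<xi> \<xi>' \<and>
     (\<forall>L2 \<xi>2 \<xi>2'. feasible vb w xO xD L2 \<xi>2 \<xi>2' \<longrightarrow> Tfun vb w \<xi> \<xi>' \<le> Tfun vb w \<xi>2 \<xi>2')"

definition Lag :: "real \<Rightarrow> (pt \<Rightarrow> pt) \<Rightarrow> real \<Rightarrow> (real \<Rightarrow> pt) \<Rightarrow> (real \<Rightarrow> pt) \<Rightarrow> (real \<Rightarrow> real) \<Rightarrow> real" where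
  "Lag vb w L \<xi> \<xi>' lam = Tfun vb w \<xi> \<xi>' +
     integral\<^sup>L (lebesgue_on {0..1::real}) (\<lambda>t. lam t * (\<xi>' t \<bullet> \<xi>' t - L\<^sup>2))"

definition first_order :: "real \<Rightarrow> (pt \<Rightarrow> pt) \<Rightarrow> real \<Rightarrow> (real \<Rightarrow> pt) \<Rightarrow> (real \<Rightarrow> pt) \<Rightarrow> (real \<Rightarrow> real) \<Rightarrow> bool" where
  "first_order vb w L \<xi> \<xi>' lam \<longleftrightarrow>
     (\<forall>dL d\<xi> d\<xi>' dlam. (dL, d\<xi>, d\<xi>') \<in> dZset \<and> Linf_space dlam \<longrightarrow>
        ((\<lambda>s. Lag vb w (L + s * dL) (\<lambda>t. \<xi> t + s *\<^sub>R d\<xi> t) (\<lambda>t. \<xi>' t + s *\<^sub>R d\<xi>' t)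
                 (\<lambda>t. lam t + s * dlam t)) has_real_derivative 0) (at 0))"

definition Lzz :: "real \<Rightarrow> (pt \<Rightarrow> pt) \<Rightarrow> real \<Rightarrow> (real \<Rightarrow> pt) \<Rightarrow> (real \<Rightarrow> pt) \<Rightarrow> (real \<Rightarrow> real)
                 \<Rightarrow> real \<Rightarrow> (real \<Rightarrow> pt) \<Rightarrow> (real \<Rightarrow> pt) \<Rightarrow> real" where
  "Lzz vb w L \<xi> \<xi>' lam dL d\<xi> d\<xi>' = T2 vb w \<xi> \<xi>' d\<xi> d\<xi>' +
     2 * integral\<^sup>L (lebesgue_on {0..1::real}) (\<lambda>t. lam t * (d\<xi>' t \<bullet> d\<xi>' t - dL\<^sup>2))"

definition SOSC :: "real \<Rightarrow> (pt \<Rightarrow> pt) \<Rightarrow> real \<Rightarrow> (real \<Rightarrow> pt) \<Rightarrow> (real \<Rightarrow> pt) \<Rightarrow> real \<Rightarrow> bool" where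
  "SOSC vb w L \<xi> \<xi>' B \<longleftrightarrow>
     (\<exists>\<kappa>>0. (INF dlam \<in> {dlam. L2_space dlam \<and> L2norm dlam \<noteq> 0}.
               SUP dz \<in> {dz \<in> dZset. Z2norm (fst dz) (fst (snd dz)) (snd (snd dz)) \<noteq> 0}.
                 ereal (integral\<^sup>L (lebesgue_on {0..1::real})
                          (\<lambda>t. dlam t * (2 * (\<xi>' t \<bullet> snd (snd dz) t) - 2 * L * fst dz))
                        / (L2norm dlam * Z2norm (fst dz) (fst (snd dz)) (snd (snd dz)))))
             \<ge> ereal \<kappa>) \<and>
     (\<forall>dL d\<xi> d\<xi>'. (dL, d\<xi>, d\<xi>') \<in> dZset \<and> ae01 (\<lambda>t. d\<xi>' t \<bullet> \<xi>' t = dL * L) \<longrightarrow>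
        T2 vb w \<xi> \<xi>' d\<xi> d\<xi>' \<ge> B * (Z2norm dL d\<xi> d\<xi>')\<^sup>2)"

text \<open>The constant \<open>\<Gamma>bar(R)\<close>; \<open>Lt\<close> is \<open>\<tilde>L = \<parallel>x_D - x_O\<parallel>\<close>.\<close>
definition Gamma_bar :: "real \<Rightarrow> real \<Rightarrow> real \<Rightarrow> real \<Rightarrow> real \<Rightarrow> real \<Rightarrow> real \<Rightarrow> real" where
  "Gamma_bar vb c0 c1 c2 c3 Lt R =
    (let vu = sqrt (vb\<^sup>2 - c0\<^sup>2);
         g0 = 2 / vu ^ 4 * (37 * c1 ^ 3 + 21 * c1 * c2 * vu + 2 * c3 * vu\<^sup>2);
         g1 = (29 * c1\<^sup>2 + 7 * vu * c2) / vu ^ 3;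
         g2 = (57 * c1\<^sup>2 + 13 * vu * c2) / vu ^ 3;
         g3 = 40 * c1 / vu\<^sup>2;
         g4 = 20 * c1 / vu\<^sup>2;
         g5 = 18 / vu
     in Max {((vb + c0) / (vb - c0) * Lt + R) * g0 + g2 / 2,
             g4 / (Lt - R) + g2 / 2,
             g1 + g3 / (2 * (Lt - R)),
             g3 / (2 * (Lt - R)) + g5 / (Lt - R)\<^sup>2})"

end

theory Submission
  imports Defs
begin

text \<open>
  On \<open>{(x, p). p \<noteq> 0}\<close> the running cost is twice continuously differentiable, so differentiation under
  the integral sign turns \<open>T2\<close> into the integral of a quadratic form \<open>H (\<xi>, \<xi>\<^sub>\<tau>)\<close> whose coefficients
  are bounded and uniformly continuous on compact sets away from \<open>p = 0\<close>.  Near the optimum the form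
  therefore differs from the form at the optimum by at most \<open>B / 4\<close> times the squared \<open>L\<^sup>2\<close>-norm.
  A direction tangent to the constraint at a nearby point violates the linearised constraint at the
  optimum by a residual of size \<open>R\<close>.  Since the linearised constraint has a bounded right inverse
  within bounded directions, the direction can be corrected at relative cost \<open>O(R)\<close>, after which the
  second order condition applies.  All error terms vanish as \<open>R \<rightarrow> 0\<close>, while \<open>Gamma_bar\<close> stays
  positive and bounded.
\<close>

section \<open>Twice continuously differentiable functions\<close>

text \<open>The obstacle is a gap between two norms. The coefficients of the second derivative of
  \<open>Tfun\<close> are controlled only through pointwise bounds on a curve and its velocity,
  whereas coercivity is measured in \<open>Z2norm\<close>. Curves are therefore compared in the
  supremum norm, and directions enter only through their squares under the integral. For the same
  reason a corrected direction has to meet two demands at once: it must stay in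
  \<open>dZset\<close>, hence have a bounded derivative, and the \<open>Z2norm\<close> of the
  correction must be controlled by the L2 norm of the residual alone. The cost is positively
  homogeneous of degree one in \<open>p\<close> and not differentiable at \<open>p = 0\<close>. The
  constraint at the optimum keeps the argument away from there: the speed is constantly
  \<open>\<bar>Lst\<bar>\<close>, nonzero because the end points differ, and nearby curves keep at
  least half of it. \<open>Gamma_bar\<close> depends on \<open>R\<close>, so the bound on
  \<open>R\<close> is implicit. Each requirement is shown to hold eventually along
  \<open>at_right 0\<close>, and finitely many such requirements hold simultaneously for some
  \<open>R\<close>.\<close>

text \<open>The derivative is only required to be continuous in each fixed direction.  In finite dimensions
  this is ordinary continuity, and it spares the bounded linear function types.\<close>

definition C1_on :: "'a::real_normed_vector set \<Rightarrow> ('a \<Rightarrow> 'b::real_normed_vector) \<Rightarrow> bool" where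
  "C1_on U f \<longleftrightarrow> (\<exists>f'. (\<forall>x\<in>U. (f has_derivative f' x) (at x)) \<and>
     (\<forall>h. continuous_on U (\<lambda>x. f' x h)))"

definition C2_on :: "'a::real_normed_vector set \<Rightarrow> ('a \<Rightarrow> 'b::real_normed_vector) \<Rightarrow> bool" where
  "C2_on U f \<longleftrightarrow> (\<exists>f'. (\<forall>x\<in>U. (f has_derivative f' x) (at x)) \<and>
     (\<forall>h. C1_on U (\<lambda>x. f' x h)))"

lemma C1_onI:
  assumes "\<And>x. x \<in> U \<Longrightarrow> (f has_derivative f' x) (at x)"
    and "\<And>h. continuous_on U (\<lambda>x. f' x h)"
  shows "C1_on U f"
  using assms unfolding C1_on_def by blast

lemma C2_onI:
  assumes "\<And>x. x \<in> U \<Longrightarrow> (f has_derivative f' x) (at x)"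
    and "\<And>h. C1_on U (\<lambda>x. f' x h)"
  shows "C2_on U f"
  using assms unfolding C2_on_def by blast

lemma C1_onE:
  assumes "C1_on U f"
  obtains f' where "\<And>x. x \<in> U \<Longrightarrow> (f has_derivative f' x) (at x)"
    and "\<And>h. continuous_on U (\<lambda>x. f' x h)"
  using assms unfolding C1_on_def by blast

lemma C2_onE:
  assumes "C2_on U f"
  obtains f' where "\<And>x. x \<in> U \<Longrightarrow> (f has_derivative f' x) (at x)"
    and "\<And>h. C1_on U (\<lambda>x. f' x h)"
  using assms unfolding C2_on_def by blast

lemma C1_on_imp_continuous_on: "C1_on U f \<Longrightarrow> continuous_on U f"
  by (metis C1_onE has_derivative_at_withinI has_derivative_continuous_on)

lemma C2_on_imp_C1_on: "C2_on U f \<Longrightarrow> C1_on U f"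
  by (metis C1_onI C2_onE C1_on_imp_continuous_on)

lemma C1_on_const: "C1_on U (\<lambda>x. c)"
  by (rule C1_onI[where f' = "\<lambda>x h. 0"]) auto

lemma C2_on_const: "C2_on U (\<lambda>x. c)"
  by (rule C2_onI[where f' = "\<lambda>x h. 0"]) (auto intro: C1_on_const)

lemma C2_on_bounded_linear: "bounded_linear f \<Longrightarrow> C2_on U f"
  by (rule C2_onI[where f' = "\<lambda>x. f"]) (auto intro: C1_on_const bounded_linear_imp_has_derivative)

lemma C1_on_add:
  assumes "C1_on U f" "C1_on U g"
  shows "C1_on U (\<lambda>x. f x + g x)"
proof -
  obtain f' where f: "\<And>x. x \<in> U \<Longrightarrow> (f has_derivative f' x) (at x)" "\<And>h. continuous_on U (\<lambda>x. f' x h)"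
    using C1_onE[OF assms(1)] by blast
  obtain g' where g: "\<And>x. x \<in> U \<Longrightarrow> (g has_derivative g' x) (at x)" "\<And>h. continuous_on U (\<lambda>x. g' x h)"
    using C1_onE[OF assms(2)] by blast
  show ?thesis
    by (rule C1_onI[where f' = "\<lambda>x h. f' x h + g' x h"]) (auto intro!: f g derivative_intros continuous_intros)
qed

lemma C2_on_add:
  assumes "C2_on U f" "C2_on U g"
  shows "C2_on U (\<lambda>x. f x + g x)"
proof -
  obtain f' where f: "\<And>x. x \<in> U \<Longrightarrow> (f has_derivative f' x) (at x)" "\<And>h. C1_on U (\<lambda>x. f' x h)"
    using C2_onE[OF assms(1)] by blast
  obtain g' where g: "\<And>x. x \<in> U \<Longrightarrow> (g has_derivative g' x) (at x)" "\<And>h. C1_on U (\<lambda>x. g' x h)"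
    using C2_onE[OF assms(2)] by blast
  show ?thesis
    by (rule C2_onI[where f' = "\<lambda>x h. f' x h + g' x h"]) (auto intro!: f g derivative_intros C1_on_add)
qed

text \<open>Any bounded bilinear product is allowed, so that the inner products and the real
  products from which the cost is assembled are instances of one rule.\<close>

lemma (in bounded_bilinear) C1_on:
  assumes "C1_on U f" "C1_on U g"
  shows "C1_on U (\<lambda>x. prod (f x) (g x))"
proof -
  obtain f' where f: "\<And>x. x \<in> U \<Longrightarrow> (f has_derivative f' x) (at x)" "\<And>h. continuous_on U (\<lambda>x. f' x h)"
    using C1_onE[OF assms(1)] by blast
  obtain g' where g: "\<And>x. x \<in> U \<Longrightarrow> (g has_derivative g' x) (at x)" "\<And>h. continuous_on U (\<lambda>x. g' x h)"
    using C1_onE[OF assms(2)] by blast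
  note c = assms[THEN C1_on_imp_continuous_on]
  show ?thesis
    by (rule C1_onI[where f' = "\<lambda>x h. prod (f x) (g' x h) + prod (f' x h) (g x)"])
      (auto intro!: f g c FDERIV continuous_on continuous_intros)
qed

lemma (in bounded_bilinear) C2_on:
  assumes "C2_on U f" "C2_on U g"
  shows "C2_on U (\<lambda>x. prod (f x) (g x))"
proof -
  obtain f' where f: "\<And>x. x \<in> U \<Longrightarrow> (f has_derivative f' x) (at x)" "\<And>h. C1_on U (\<lambda>x. f' x h)"
    using C2_onE[OF assms(1)] by blast
  obtain g' where g: "\<And>x. x \<in> U \<Longrightarrow> (g has_derivative g' x) (at x)" "\<And>h. C1_on U (\<lambda>x. g' x h)"
    using C2_onE[OF assms(2)] by blast
  note c = assms[THEN C2_on_imp_C1_on]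
  show ?thesis
    by (rule C2_onI[where f' = "\<lambda>x h. prod (f x) (g' x h) + prod (f' x h) (g x)"])
      (auto intro!: f g c FDERIV C1_on C1_on_add)
qed

text \<open>The outer function has to be differentiable only at the values that \<open>f\<close>
  takes on \<open>U\<close>. This admits \<open>inverse\<close> and \<open>sqrt\<close>.\<close>

lemma C1_on_real_compose:
  fixes f :: "'a::real_normed_vector \<Rightarrow> real"
  assumes f: "C1_on U f"
    and \<phi>: "\<And>x. x \<in> U \<Longrightarrow> (\<phi> has_real_derivative \<phi>' (f x)) (at (f x))"
    and \<phi>': "continuous_on U (\<lambda>x. \<phi>' (f x))"
  shows "C1_on U (\<lambda>x. \<phi> (f x))"
proof -
  obtain f' where f: "\<And>x. x \<in> U \<Longrightarrow> (f has_derivative f' x) (at x)" "\<And>h. continuous_on U (\<lambda>x. f' x h)"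
    using C1_onE[OF assms(1)] by blast
  show ?thesis
    by (rule C1_onI[where f' = "\<lambda>x h. \<phi>' (f x) * f' x h"])
      (auto intro!: f \<phi>' continuous_intros has_derivative_compose[OF f(1) has_field_derivative_imp_has_derivative[OF \<phi>]])
qed

lemma C2_on_real_compose:
  fixes f :: "'a::real_normed_vector \<Rightarrow> real"
  assumes f: "C2_on U f"
    and \<phi>: "\<And>x. x \<in> U \<Longrightarrow> (\<phi> has_real_derivative \<phi>' (f x)) (at (f x))"
    and \<phi>': "\<And>x. x \<in> U \<Longrightarrow> (\<phi>' has_real_derivative \<phi>'' (f x)) (at (f x))"
    and \<phi>'': "continuous_on U (\<lambda>x. \<phi>'' (f x))"
  shows "C2_on U (\<lambda>x. \<phi> (f x))"
proof -
  obtain f' where f: "\<And>x. x \<in> U \<Longrightarrow> (f has_derivative f' x) (at x)" "\<And>h. C1_on U (\<lambda>x. f' x h)"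
    using C2_onE[OF assms(1)] by blast
  have *: "C1_on U (\<lambda>x. \<phi>' (f x))"
    by (rule C1_on_real_compose[OF C2_on_imp_C1_on[OF assms(1)] \<phi>' \<phi>''])
  show ?thesis
    by (rule C2_onI[where f' = "\<lambda>x h. \<phi>' (f x) * f' x h"])
      (auto intro!: f * bounded_bilinear.C1_on[OF bounded_bilinear_mult] has_derivative_compose[OF f(1) has_field_derivative_imp_has_derivative[OF \<phi>]])
qed

lemma C2_on_sqrt:
  fixes f :: "'a::real_normed_vector \<Rightarrow> real"
  assumes f: "C2_on U f" and pos: "\<And>x. x \<in> U \<Longrightarrow> f x > 0"
  shows "C2_on U (\<lambda>x. sqrt (f x))"
\<comment> \<open>The unsimplified second derivative is the expression that
  \<open>DERIV_inverse'\<close> produces for \<open>inverse (sqrt y)\<close>.\<close>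
proof (rule C2_on_real_compose[OF f, where \<phi>' = "\<lambda>y. inverse (sqrt y) / 2"
      and \<phi>'' = "\<lambda>y. - (inverse (sqrt y) * (inverse (sqrt y) / 2) * inverse (sqrt y)) / 2"])
  fix x assume "x \<in> U"
  then have p: "f x > 0" by (rule pos)
  show "(sqrt has_real_derivative inverse (sqrt (f x)) / 2) (at (f x))"
    by (rule DERIV_real_sqrt[OF p])
  show "((\<lambda>y. inverse (sqrt y) / 2) has_real_derivative
      - (inverse (sqrt (f x)) * (inverse (sqrt (f x)) / 2) * inverse (sqrt (f x))) / 2) (at (f x))"
    using p by (intro DERIV_cdivide DERIV_inverse' DERIV_real_sqrt) auto
next
  have "continuous_on U f"
    by (intro C1_on_imp_continuous_on C2_on_imp_C1_on f)
  then show "continuous_on U (\<lambda>x. - (inverse (sqrt (f x)) * (inverse (sqrt (f x)) / 2) * inverse (sqrt (f x))) / 2)"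
    using pos by (intro continuous_intros) (auto dest: pos)
qed

lemma C2_on_inverse:
  fixes f :: "'a::real_normed_vector \<Rightarrow> real"
  assumes f: "C2_on U f" and nz: "\<And>x. x \<in> U \<Longrightarrow> f x \<noteq> 0"
  shows "C2_on U (\<lambda>x. inverse (f x))"
proof (rule C2_on_real_compose[OF f, where \<phi>' = "\<lambda>y. - (inverse y * inverse y)"
      and \<phi>'' = "\<lambda>y. 2 * inverse y ^ 3"])
  fix x assume "x \<in> U"
  then have p: "f x \<noteq> 0" by (rule nz)
  show "(inverse has_real_derivative - (inverse (f x) * inverse (f x))) (at (f x))"
    using DERIV_inverse[OF p] by (simp add: power2_eq_square)
  show "((\<lambda>y. - (inverse y * inverse y)) has_real_derivative 2 * inverse (f x) ^ 3) (at (f x))"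
    by (rule derivative_eq_intros refl p)+ (simp add: p field_simps power3_eq_cube)
next
  have "continuous_on U f"
    by (intro C1_on_imp_continuous_on C2_on_imp_C1_on f)
  then show "continuous_on U (\<lambda>x. 2 * inverse (f x) ^ 3)"
    using nz by (intro continuous_intros) auto
qed

section \<open>Regularity of the running cost\<close>

lemma sqrt_arg_pos:
  fixes w :: "pt \<Rightarrow> pt"
  assumes "norm (w x) < vb" "p \<noteq> 0"
  shows "vb\<^sup>2 - w x \<bullet> w x > 0" "(p \<bullet> w x)\<^sup>2 + (vb\<^sup>2 - w x \<bullet> w x) * (p \<bullet> p) > 0"
proof -
  show *: "vb\<^sup>2 - w x \<bullet> w x > 0"
    using assms(1) by (simp add: dot_square_norm power_strict_mono)
  show "(p \<bullet> w x)\<^sup>2 + (vb\<^sup>2 - w x \<bullet> w x) * (p \<bullet> p) > 0"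
    by (intro add_nonneg_pos mult_pos_pos *) (use assms in auto)
qed

text \<open>Smoothness can fail only at a zero of the denominator or of the radicand. Wind slower
  than \<open>vb\<close> together with \<open>p \<noteq> 0\<close> keeps both positive.\<close>

lemma fcost_C2_on:
  fixes w :: "pt \<Rightarrow> pt"
  assumes w: "\<And>x. (w has_derivative blinfun_apply (Dw x)) (at x)"
             "\<And>x. (Dw has_derivative blinfun_apply (D2w x)) (at x)"
             "continuous_on UNIV D2w"
    and lt: "\<And>x. norm (w x) < vb"
  shows "C2_on {z. snd z \<noteq> 0} (\<lambda>z. fcost vb w (fst z) (snd z))"
proof -
  let ?U = "{z::pt\<times>pt. snd z \<noteq> 0}"
  have W: "C2_on ?U (\<lambda>z. w (fst z))"
  proof (rule C2_onI[where f' = "\<lambda>z h. Dw (fst z) (fst h)"])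
    show "((\<lambda>z. w (fst z)) has_derivative (\<lambda>h. Dw (fst z) (fst h))) (at z)" for z :: "pt\<times>pt"
      by (rule has_derivative_compose[OF has_derivative_fst[OF has_derivative_ident] w(1)])
    fix h :: "pt\<times>pt"
    show "C1_on ?U (\<lambda>z. Dw (fst z) (fst h))"
    proof (rule C1_onI[where f' = "\<lambda>z k. D2w (fst z) (fst k) (fst h)"])
      fix z :: "pt \<times> pt"
      have "((\<lambda>z. Dw (fst z)) has_derivative (\<lambda>k. D2w (fst z) (fst k))) (at z)"
        by (rule has_derivative_compose[OF has_derivative_fst[OF has_derivative_ident] w(2)])
      then show "((\<lambda>z. Dw (fst z) (fst h)) has_derivative (\<lambda>k. D2w (fst z) (fst k) (fst h))) (at z)"
        by (rule bounded_linear.has_derivative[OF bounded_bilinear.bounded_linear_left[OF bounded_bilinear_blinfun_apply]])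
    next
      fix k :: "pt\<times>pt"
      have "continuous_on ?U (\<lambda>z. D2w (fst z))"
        by (rule continuous_on_compose2[OF w(3)]) (auto intro: continuous_intros)
      then show "continuous_on ?U (\<lambda>z. D2w (fst z) (fst k) (fst h))"
        by (intro continuous_intros)
    qed
  qed
  have P: "C2_on ?U snd"
    by (rule C2_on_bounded_linear[OF bounded_linear_snd])
  note inn = bounded_bilinear.C2_on[OF bounded_bilinear_inner]
  note mul = bounded_bilinear.C2_on[OF bounded_bilinear_mult]
  have b: "C2_on ?U (\<lambda>z. snd z \<bullet> w (fst z))" by (rule inn[OF P W])
  \<comment> \<open>Differences are written as sums with a factor -1, the shape that the closure
    rules for sums and products accept; the concluding \<open>simp\<close> recovers
    \<open>fcost\<close>.\<close>
  have d: "C2_on ?U (\<lambda>z. vb\<^sup>2 + (-1) * (w (fst z) \<bullet> w (fst z)))"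
    by (intro C2_on_add mul C2_on_const inn W)
  have s: "C2_on ?U (\<lambda>z. (snd z \<bullet> w (fst z)) * (snd z \<bullet> w (fst z)) + (vb\<^sup>2 + (-1) * (w (fst z) \<bullet> w (fst z))) * (snd z \<bullet> snd z))"
    by (intro C2_on_add mul d b inn P)
  have "C2_on ?U (\<lambda>z. ((-1) * (snd z \<bullet> w (fst z)) + sqrt ((snd z \<bullet> w (fst z)) * (snd z \<bullet> w (fst z)) + (vb\<^sup>2 + (-1) * (w (fst z) \<bullet> w (fst z))) * (snd z \<bullet> snd z)))
     * inverse (vb\<^sup>2 + (-1) * (w (fst z) \<bullet> w (fst z))))"
    using sqrt_arg_pos[of w, OF lt]
    by (intro mul C2_on_add C2_on_inverse C2_on_sqrt b C2_on_const d s)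
       (auto simp: power2_eq_square less_imp_neq[symmetric] dest: less_imp_neq)
  then show ?thesis
    by (simp add: fcost_def[abs_def] divide_inverse power2_eq_square)
qed

section \<open>Second derivatives of integral functionals\<close>

text \<open>Continuity is known only for fixed pairs of directions. Expanding in the basis turns
  finitely many entry bounds into one that is uniform in all directions; the squared dimension
  counts the entries.\<close>

lemma bilinear_norm_le_Basis:
  fixes h :: "'a::euclidean_space \<Rightarrow> 'a \<Rightarrow> real"
  assumes h: "bilinear h" and e: "\<And>i j. i \<in> Basis \<Longrightarrow> j \<in> Basis \<Longrightarrow> \<bar>h i j\<bar> \<le> e"
  shows "\<bar>h u v\<bar> \<le> e * (DIM('a))\<^sup>2 * norm u * norm v"
proof -
  have "h u v = h (\<Sum>i\<in>Basis. (u \<bullet> i) *\<^sub>R i) (\<Sum>j\<in>Basis. (v \<bullet> j) *\<^sub>R j)"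
    by (simp add: euclidean_representation)
  also have "\<dots> = (\<Sum>(i, j)\<in>Basis \<times> Basis. h ((u \<bullet> i) *\<^sub>R i) ((v \<bullet> j) *\<^sub>R j))"
    by (rule bilinear_sum[OF h])
  also have "\<dots> = (\<Sum>(i, j)\<in>Basis \<times> Basis. (u \<bullet> i) * (v \<bullet> j) * h i j)"
    by (intro sum.cong) (auto simp: bilinear_lmul[OF h] bilinear_rmul[OF h])
  also have "\<bar>\<dots>\<bar> \<le> (\<Sum>(i, j)\<in>(Basis :: 'a set) \<times> (Basis :: 'a set). e * norm u * norm v)"
    unfolding split_def
  proof (rule sum_norm_le[where 'a=real, unfolded real_norm_def])
    fix p :: "'a \<times> 'a" assume p: "p \<in> Basis \<times> Basis"
    have "\<bar>u \<bullet> fst p\<bar> * \<bar>v \<bullet> snd p\<bar> * \<bar>h (fst p) (snd p)\<bar> \<le> norm u * norm v * e"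
      using p by (intro mult_mono e Basis_le_norm) auto
    then show "\<bar>(u \<bullet> fst p) * (v \<bullet> snd p) * h (fst p) (snd p)\<bar> \<le> e * norm u * norm v"
      by (simp add: abs_mult mult_ac)
  qed
  also have "\<dots> = e * (DIM('a))\<^sup>2 * norm u * norm v"
    by (simp add: split_def card_cartesian_product power2_eq_square)
  finally show ?thesis .
qed

lemma linear_norm_le_Basis:
  fixes h :: "'a::euclidean_space \<Rightarrow> real"
  assumes h: "linear h" and e: "\<And>i. i \<in> Basis \<Longrightarrow> \<bar>h i\<bar> \<le> e"
  shows "\<bar>h v\<bar> \<le> e * DIM('a) * norm v"
proof -
  have "h v = h (\<Sum>i\<in>Basis. (v \<bullet> i) *\<^sub>R i)"
    by (simp add: euclidean_representation)
  also have "\<dots> = (\<Sum>i\<in>Basis. (v \<bullet> i) * h i)"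
    by (simp add: linear_sum[OF h] linear_cmul[OF h])
  also have "\<bar>\<dots>\<bar> \<le> (\<Sum>i\<in>(Basis :: 'a set). e * norm v)"
  proof (rule sum_norm_le[where 'a=real, unfolded real_norm_def])
    fix i :: 'a assume i: "i \<in> Basis"
    have "\<bar>v \<bullet> i\<bar> * \<bar>h i\<bar> \<le> norm v * e"
      using i by (intro mult_mono e Basis_le_norm) auto
    then show "\<bar>(v \<bullet> i) * h i\<bar> \<le> e * norm v"
      by (simp add: abs_mult mult_ac)
  qed
  also have "\<dots> = e * DIM('a) * norm v" by simp
  finally show ?thesis .
qed

text \<open>\<open>G\<close> and \<open>H\<close> stand for the first and second derivative of
  \<open>F\<close>. Derivatives along lines suffice, because \<open>T2\<close> differentiates in the
  single variable \<open>s\<close>. Linearity and joint measurability are demanded on the whole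
  space, so that \<open>G (V t) (dV t)\<close> is measurable even if \<open>V t\<close> lies in
  \<open>U\<close> only almost everywhere.\<close>

locale second_order_expansion =
  fixes U :: "'a::euclidean_space set" and F :: "'a \<Rightarrow> real"
    and G :: "'a \<Rightarrow> 'a \<Rightarrow> real" and H :: "'a \<Rightarrow> 'a \<Rightarrow> 'a \<Rightarrow> real"
  assumes F_deriv: "\<And>z v s. z + s *\<^sub>R v \<in> U \<Longrightarrow>
        ((\<lambda>s. F (z + s *\<^sub>R v)) has_real_derivative G (z + s *\<^sub>R v) v) (at s)"
    and G_deriv: "\<And>z v s. z + s *\<^sub>R v \<in> U \<Longrightarrow>
        ((\<lambda>s. G (z + s *\<^sub>R v) v) has_real_derivative H (z + s *\<^sub>R v) v v) (at s)"
    and F_cont: "continuous_on U F"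
    and G_cont: "\<And>v. continuous_on U (\<lambda>z. G z v)"
    and H_cont: "\<And>u v. continuous_on U (\<lambda>z. H z u v)"
    and G_linear: "\<And>z. linear (G z)"
    and H_bilinear: "\<And>z. bilinear (H z)"
    and G_meas: "(\<lambda>x. G (fst x) (snd x)) \<in> borel_measurable (borel \<Otimes>\<^sub>M borel)"
    and H_meas: "(\<lambda>x. H (fst x) (snd x) (snd x)) \<in> borel_measurable (borel \<Otimes>\<^sub>M borel)"

lemma C2_on_second_order_expansion:
  fixes F :: "'a::euclidean_space \<Rightarrow> real"
  assumes F: "C2_on U F" and U: "open U"
  shows "\<exists>G H. second_order_expansion U F G H"
proof -
  obtain f' where f': "\<And>x. x \<in> U \<Longrightarrow> (F has_derivative f' x) (at x)" "\<And>h. C1_on U (\<lambda>x. f' x h)"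
    using C2_onE[OF F] by blast
  have "\<forall>h. \<exists>f''. (\<forall>x\<in>U. ((\<lambda>x. f' x h) has_derivative f'' x) (at x)) \<and> (\<forall>k. continuous_on U (\<lambda>x. f'' x k))"
    using f'(2) unfolding C1_on_def by blast
  then obtain f'' where f'': "\<And>h x. x \<in> U \<Longrightarrow> ((\<lambda>x. f' x h) has_derivative f'' h x) (at x)"
      "\<And>h k. continuous_on U (\<lambda>x. f'' h x k)"
    by metis
  \<comment> \<open>Cutting off outside \<open>U\<close> makes the partial derivatives Borel measurable on the whole space.\<close>
  define g where "g i z = indicator U z *\<^sub>R f' z i" for i z
  define a where "a i j z = indicator U z *\<^sub>R f'' i z j" for i j z
  define G where "G z v = (\<Sum>i\<in>Basis. (v \<bullet> i) * g i z)" for z v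
  define H where "H z u v = (\<Sum>i\<in>Basis. \<Sum>j\<in>Basis. (u \<bullet> i) * (v \<bullet> j) * a i j z)" for z u v
  have g_cont: "continuous_on U (g i)" for i
    using C1_on_imp_continuous_on[OF f'(2)[of i]] by (rule continuous_on_eq) (simp add: g_def)
  have a_cont: "continuous_on U (a i j)" for i j
    using f''(2)[of i j] by (rule continuous_on_eq) (simp add: a_def)
  have [measurable]: "g i \<in> borel_measurable borel" for i
    unfolding g_def using U C1_on_imp_continuous_on[OF f'(2)[of i]]
    by (intro borel_measurable_continuous_on_indicator) auto
  have [measurable]: "a i j \<in> borel_measurable borel" for i j
    unfolding a_def using U f''(2)[of i j]
    by (intro borel_measurable_continuous_on_indicator) auto
  have G: "G x v = f' x v" if "x \<in> U" for x v
  proof -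
    have l: "linear (f' x)" using f'(1)[OF that] by (rule has_derivative_linear)
    have "f' x v = f' x (\<Sum>i\<in>Basis. (v \<bullet> i) *\<^sub>R i)" by (simp add: euclidean_representation)
    also have "\<dots> = G x v"
      by (simp add: linear_sum[OF l] linear_cmul[OF l] G_def g_def that)
    finally show ?thesis by simp
  qed
  \<comment> \<open>Since \<open>U\<close> is open, the cut-off changes nothing near a point of
    \<open>U\<close>, and \<open>g i\<close> inherits the derivative.\<close>
  have g_deriv: "(g i has_derivative (\<lambda>h. \<Sum>j\<in>Basis. (h \<bullet> j) * a i j x)) (at x)" if "x \<in> U" for i x
  proof -
    have l: "linear (f'' i x)" using f''(1)[OF that] by (rule has_derivative_linear)
    have "f'' i x h = (\<Sum>j\<in>Basis. (h \<bullet> j) * a i j x)" for h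
    proof -
      have "f'' i x h = f'' i x (\<Sum>i\<in>Basis. (h \<bullet> i) *\<^sub>R i)" by (simp add: euclidean_representation)
      also have "\<dots> = (\<Sum>j\<in>Basis. (h \<bullet> j) * a i j x)"
        by (simp add: linear_sum[OF l] linear_cmul[OF l] a_def that)
      finally show ?thesis .
    qed
    then have *: "f'' i x = (\<lambda>h. \<Sum>j\<in>Basis. (h \<bullet> j) * a i j x)" by auto
    show ?thesis
      using f''(1)[OF that, of i] unfolding *
      by (rule has_derivative_transform_within_open[OF _ U that]) (simp add: g_def)
  qed
  have line: "((\<lambda>s. z + s *\<^sub>R v) has_derivative (\<lambda>h. h *\<^sub>R v)) (at s)" for z v :: 'a and s
    by (auto intro!: derivative_eq_intros)
  have "second_order_expansion U F G H"
  proof (rule second_order_expansion.intro)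
    fix z v s assume z: "z + s *\<^sub>R v \<in> U"
    have l: "linear (f' (z + s *\<^sub>R v))" using f'(1)[OF z] by (rule has_derivative_linear)
    have "((\<lambda>s. F (z + s *\<^sub>R v)) has_derivative (\<lambda>h. f' (z + s *\<^sub>R v) (h *\<^sub>R v))) (at s)"
      by (rule has_derivative_compose[OF line f'(1)[OF z]])
    moreover have "(\<lambda>h. f' (z + s *\<^sub>R v) (h *\<^sub>R v)) = (*) (G (z + s *\<^sub>R v) v)"
      by (auto simp: linear_cmul[OF l] G z)
    ultimately show "((\<lambda>s. F (z + s *\<^sub>R v)) has_real_derivative G (z + s *\<^sub>R v) v) (at s)"
      by (simp add: has_field_derivative_def)
    have "((\<lambda>s. g i (z + s *\<^sub>R v)) has_derivative (\<lambda>h. \<Sum>j\<in>Basis. (h *\<^sub>R v \<bullet> j) * a i j (z + s *\<^sub>R v))) (at s)" for i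
      by (rule has_derivative_compose[OF line g_deriv[OF z]])
    then have "((\<lambda>s. g i (z + s *\<^sub>R v)) has_real_derivative (\<Sum>j\<in>Basis. (v \<bullet> j) * a i j (z + s *\<^sub>R v))) (at s)" for i
      unfolding has_field_derivative_def
      by (rule has_derivative_eq_rhs) (auto simp: fun_eq_iff sum_distrib_right intro!: sum.cong)
    then have "((\<lambda>s. G (z + s *\<^sub>R v) v) has_real_derivative (\<Sum>i\<in>Basis. (v \<bullet> i) * (\<Sum>j\<in>Basis. (v \<bullet> j) * a i j (z + s *\<^sub>R v)))) (at s)"
      unfolding G_def by (intro DERIV_sum DERIV_cmult)
    then show "((\<lambda>s. G (z + s *\<^sub>R v) v) has_real_derivative H (z + s *\<^sub>R v) v v) (at s)"
      by (simp add: H_def sum_distrib_left mult.assoc)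
  next
    show "continuous_on U F"
      by (intro C1_on_imp_continuous_on C2_on_imp_C1_on F)
    show "continuous_on U (\<lambda>z. G z v)" for v
      unfolding G_def by (intro continuous_intros g_cont)
    show "continuous_on U (\<lambda>z. H z u v)" for u v
      unfolding H_def by (intro continuous_intros a_cont)
    show "linear (G z)" for z
      by (rule linearI) (simp_all add: G_def algebra_simps sum.distrib sum_distrib_left)
    show "bilinear (H z)" for z
      unfolding bilinear_def
      by (auto intro!: linearI simp: H_def algebra_simps sum.distrib sum_distrib_left)
    show "(\<lambda>x. G (fst x) (snd x)) \<in> borel_measurable (borel \<Otimes>\<^sub>M borel)"
      unfolding G_def by measurable
    show "(\<lambda>x. H (fst x) (snd x) (snd x)) \<in> borel_measurable (borel \<Otimes>\<^sub>M borel)"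
      unfolding H_def by measurable
  qed
  then show ?thesis by blast
qed

text \<open>By the mean value inequality on the convex set \<open>S\<close>, the constant
  \<open>C\<close> dominates all difference quotients, and constants are integrable for a finite
  measure. The exceptional null set must not depend on \<open>s\<close>, hence the order of the
  quantifiers in \<open>d\<close>.\<close>

lemma (in finite_measure) has_real_derivative_lebesgue_integral:
  fixes g g' :: "real \<Rightarrow> 'a \<Rightarrow> real"
  assumes S: "open S" "convex S" "s0 \<in> S"
    and int: "\<And>s. s \<in> S \<Longrightarrow> integrable M (g s)"
    and meas: "g' s0 \<in> borel_measurable M"
    and d: "AE t in M. \<forall>s\<in>S. ((\<lambda>s. g s t) has_real_derivative g' s t) (at s) \<and> \<bar>g' s t\<bar> \<le> C"
  shows "((\<lambda>s. \<integral>t. g s t \<partial>M) has_real_derivative (\<integral>t. g' s0 t \<partial>M)) (at s0)"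
proof -
  have "((\<lambda>s. ((\<integral>t. g s t \<partial>M) - (\<integral>t. g s0 t \<partial>M)) / (s - s0)) \<longlongrightarrow> (\<integral>t. g' s0 t \<partial>M)) (at s0 within S)"
    unfolding tendsto_at_iff_sequentially o_def
  proof (intro allI impI)
    fix X :: "nat \<Rightarrow> real" assume X: "\<forall>i. X i \<in> S - {s0}" and lim: "X \<longlonglongrightarrow> s0"
    have "(\<lambda>n. \<integral>t. (g (X n) t - g s0 t) / (X n - s0) \<partial>M) \<longlonglongrightarrow> (\<integral>t. g' s0 t \<partial>M)"
    proof (rule integral_dominated_convergence[where w = "\<lambda>_. C"])
      show "(\<lambda>t. (g (X n) t - g s0 t) / (X n - s0)) \<in> borel_measurable M" for n
        using int[of "X n"] int[of s0] X S by (intro measurable) auto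
      show "AE t in M. (\<lambda>n. (g (X n) t - g s0 t) / (X n - s0)) \<longlonglongrightarrow> g' s0 t"
        using d
      proof (eventually_elim)
        fix t assume "\<forall>s\<in>S. ((\<lambda>s. g s t) has_real_derivative g' s t) (at s) \<and> \<bar>g' s t\<bar> \<le> C"
        then have "((\<lambda>s. g s t) has_real_derivative g' s0 t) (at s0 within S)"
          using S by (auto intro: has_field_derivative_at_within)
        then show "(\<lambda>n. (g (X n) t - g s0 t) / (X n - s0)) \<longlonglongrightarrow> g' s0 t"
          unfolding has_field_derivative_iff tendsto_at_iff_sequentially o_def using X lim by blast
      qed
      show "AE t in M. norm ((g (X n) t - g s0 t) / (X n - s0)) \<le> C" for n
        using d
      proof (eventually_elim)
        fix t assume "\<forall>s\<in>S. ((\<lambda>s. g s t) has_real_derivative g' s t) (at s) \<and> \<bar>g' s t\<bar> \<le> C"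
        then have "norm (g (X n) t - g s0 t) \<le> C * norm (X n - s0)"
          using X S
          by (intro field_differentiable_bound[OF S(2), where f = "\<lambda>s. g s t" and f' = "\<lambda>s. g' s t"])
             (auto intro: has_field_derivative_at_within)
        then show "norm ((g (X n) t - g s0 t) / (X n - s0)) \<le> C"
          using X by (simp add: norm_divide divide_le_eq)
      qed
    qed (use meas in auto)
    moreover have "(\<integral>t. (g (X n) t - g s0 t) / (X n - s0) \<partial>M)
        = ((\<integral>t. g (X n) t \<partial>M) - (\<integral>t. g s0 t \<partial>M)) / (X n - s0)" for n
      using int X S by simp
    ultimately show "(\<lambda>n. ((\<integral>t. g (X n) t \<partial>M) - (\<integral>t. g s0 t \<partial>M)) / (X n - s0)) \<longlonglongrightarrow> (\<integral>t. g' s0 t \<partial>M)"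
      by (simp only:)
  qed
  then have "((\<lambda>s. \<integral>t. g s t \<partial>M) has_real_derivative (\<integral>t. g' s0 t \<partial>M)) (at s0 within S)"
    by (simp add: has_field_derivative_iff)
  then show ?thesis
    using at_within_open[OF S(3,1)] by simp
qed

context second_order_expansion
begin

lemma G_bound:
  assumes "compact K" "K \<subseteq> U"
  shows "\<exists>N\<ge>0. \<forall>z\<in>K. \<forall>v. \<bar>G z v\<bar> \<le> N * norm v"
proof -
  have "\<exists>e. \<forall>z\<in>K. \<bar>G z i\<bar> \<le> e" for i
    using compact_imp_bounded[OF compact_continuous_image[OF continuous_on_subset[OF G_cont assms(2)] assms(1)], of i]
    by (auto simp: bounded_iff)
  then obtain e where e: "\<And>i z. z \<in> K \<Longrightarrow> \<bar>G z i\<bar> \<le> e i" by metis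
  define N where "N = (\<Sum>i\<in>Basis. \<bar>e i\<bar>) * DIM('a)"
  have "\<bar>G z v\<bar> \<le> N * norm v" if "z \<in> K" for z v
    unfolding N_def
  proof (rule linear_norm_le_Basis[OF G_linear])
    fix i :: 'a assume i: "i \<in> Basis"
    have "\<bar>G z i\<bar> \<le> \<bar>e i\<bar>" using e[OF that, of i] by linarith
    also have "\<dots> \<le> (\<Sum>i\<in>Basis. \<bar>e i\<bar>)" using i by (intro member_le_sum) auto
    finally show "\<bar>G z i\<bar> \<le> (\<Sum>i\<in>Basis. \<bar>e i\<bar>)" .
  qed
  moreover have "N \<ge> 0" by (simp add: N_def sum_nonneg)
  ultimately show ?thesis by blast
qed

lemma H_bound:
  assumes "compact K" "K \<subseteq> U"
  shows "\<exists>N\<ge>0. \<forall>z\<in>K. \<forall>u v. \<bar>H z u v\<bar> \<le> N * norm u * norm v"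
proof -
  have "\<exists>e. \<forall>z\<in>K. \<bar>H z i j\<bar> \<le> e" for i j
    using compact_imp_bounded[OF compact_continuous_image[OF continuous_on_subset[OF H_cont assms(2)] assms(1)], of i j]
    by (auto simp: bounded_iff)
  then obtain e where e: "\<And>i j z. z \<in> K \<Longrightarrow> \<bar>H z i j\<bar> \<le> e i j" by metis
  define N where "N = (\<Sum>p\<in>Basis\<times>Basis. \<bar>e (fst p) (snd p)\<bar>) * (DIM('a))\<^sup>2"
  have "\<bar>H z u v\<bar> \<le> N * norm u * norm v" if "z \<in> K" for z u v
    unfolding N_def
  proof (rule bilinear_norm_le_Basis[OF H_bilinear])
    fix i j :: 'a assume i: "i \<in> Basis" "j \<in> Basis"
    have "\<bar>H z i j\<bar> \<le> \<bar>e (fst (i,j)) (snd (i,j))\<bar>" using e[OF that, of i j] by simp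
    also have "\<dots> \<le> (\<Sum>p\<in>Basis\<times>Basis. \<bar>e (fst p) (snd p)\<bar>)"
      using i by (intro member_le_sum) auto
    finally show "\<bar>H z i j\<bar> \<le> (\<Sum>p\<in>Basis\<times>Basis. \<bar>e (fst p) (snd p)\<bar>)" .
  qed
  moreover have "N \<ge> 0" by (simp add: N_def sum_nonneg)
  ultimately show ?thesis by blast
qed

lemma H_uniformly_continuous:
  assumes K: "compact K" "K \<subseteq> U" and \<epsilon>: "\<epsilon> > 0"
  shows "\<exists>\<delta>>0. \<forall>z\<in>K. \<forall>y\<in>K. dist z y < \<delta> \<longrightarrow> (\<forall>u v. \<bar>H z u v - H y u v\<bar> \<le> \<epsilon> * norm u * norm v)"
proof -
  \<comment> \<open>Absorbs in advance the squared dimension that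
    \<open>bilinear_norm_le_Basis\<close> costs.\<close>
  define \<epsilon>' where "\<epsilon>' = \<epsilon> / (DIM('a))\<^sup>2"
  have \<epsilon>': "\<epsilon>' > 0" using \<epsilon> by (simp add: \<epsilon>'_def)
  have "\<exists>\<delta>>0. \<forall>z\<in>K. \<forall>y\<in>K. dist y z < \<delta> \<longrightarrow> dist (H y i j) (H z i j) < \<epsilon>'" for i j
    using compact_uniformly_continuous[OF continuous_on_subset[OF H_cont K(2)] K(1), of i j] \<epsilon>'
    unfolding uniformly_continuous_on_def by blast
  then obtain d where d: "\<And>i j. d i j > 0"
    "\<And>i j y z. z \<in> K \<Longrightarrow> y \<in> K \<Longrightarrow> dist y z < d i j \<Longrightarrow> dist (H y i j) (H z i j) < \<epsilon>'" by metis
  define \<delta> where "\<delta> = Min ((\<lambda>p. d (fst p) (snd p)) ` (Basis\<times>Basis))"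
  have fin: "finite ((\<lambda>p. d (fst p) (snd p)) ` (Basis\<times>Basis))"
    and ne: "(\<lambda>p. d (fst p) (snd p)) ` (Basis\<times>Basis) \<noteq> {}" by auto
  have "\<delta> > 0" unfolding \<delta>_def using d(1) by (subst Min_gr_iff[OF fin ne]) auto
  moreover have "\<bar>H z u v - H y u v\<bar> \<le> \<epsilon> * norm u * norm v" if z: "z \<in> K" "y \<in> K" "dist z y < \<delta>" for z y u v
  proof -
    have l: "bilinear (\<lambda>u v. H z u v - H y u v)"
      using H_bilinear[of z] H_bilinear[of y] unfolding bilinear_def
      by (auto intro: linear_compose_sub)
    have "\<bar>H z u v - H y u v\<bar> \<le> \<epsilon>' * (DIM('a))\<^sup>2 * norm u * norm v"
    proof (rule bilinear_norm_le_Basis[OF l])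
      fix i j :: 'a assume "i \<in> Basis" "j \<in> Basis"
      then have "\<delta> \<le> d i j" unfolding \<delta>_def using fin by (intro Min_le) force+
      then show "\<bar>H z i j - H y i j\<bar> \<le> \<epsilon>'"
        using d(2)[of y z i j] z by (simp add: dist_real_def less_imp_le)
    qed
    then show ?thesis by (simp add: \<epsilon>'_def)
  qed
  ultimately show ?thesis by blast
qed

lemma measurable_along:
  assumes [measurable]: "V \<in> borel_measurable M" "dV \<in> borel_measurable M"
  shows "(\<lambda>t. G (V t) (dV t)) \<in> borel_measurable M" "(\<lambda>t. H (V t) (dV t) (dV t)) \<in> borel_measurable M"
  using measurable_compose[OF _ G_meas, of "\<lambda>t. (V t, dV t)" M] 
    measurable_compose[OF _ H_meas, of "\<lambda>t. (V t, dV t)" M] by auto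

text \<open>\<open>K\<close> contains the whole perturbed segment for almost every \<open>t\<close>,
  so the bounds of \<open>G\<close> and \<open>H\<close> on \<open>K\<close> serve as dominating
  constants for both differentiations.\<close>

lemma second_deriv_integral:
  assumes "finite_measure M"
    and V: "V \<in> borel_measurable M" and dV: "dV \<in> borel_measurable M"
    and F: "F \<in> borel_measurable borel"
    and K: "compact K" "K \<subseteq> U" and e: "e > 0"
    and VK: "AE t in M. \<forall>s\<in>{-e<..<e}. V t + s *\<^sub>R dV t \<in> K"
    and C: "AE t in M. norm (dV t) \<le> C"
  shows "deriv (deriv (\<lambda>s. \<integral>t. F (V t + s *\<^sub>R dV t) \<partial>M)) 0 = (\<integral>t. H (V t) (dV t) (dV t) \<partial>M)"
proof -
  interpret finite_measure M by fact
  let ?S = "{-e<..<e}"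
  note [measurable] = V dV F
  obtain N1 where N1: "N1 \<ge> 0" "\<And>z v. z \<in> K \<Longrightarrow> \<bar>G z v\<bar> \<le> N1 * norm v"
    using G_bound[OF K] by blast
  obtain N2 where N2: "N2 \<ge> 0" "\<And>z u v. z \<in> K \<Longrightarrow> \<bar>H z u v\<bar> \<le> N2 * norm u * norm v"
    using H_bound[OF K] by blast
  obtain N0 where N0: "\<And>z. z \<in> K \<Longrightarrow> \<bar>F z\<bar> \<le> N0"
    using compact_imp_bounded[OF compact_continuous_image[OF continuous_on_subset[OF F_cont K(2)] K(1)]]
    by (auto simp: bounded_iff)
  have mV: "(\<lambda>t. V t + s *\<^sub>R dV t) \<in> borel_measurable M" for s by measurable
  have G_le: "\<bar>G z v\<bar> \<le> N1 * C" if "z \<in> K" "norm v \<le> C" for z v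
    using N1(2)[OF that(1), of v] mult_left_mono[OF that(2) N1(1)] by linarith
  have H_le: "\<bar>H z v v\<bar> \<le> N2 * C * C" if "z \<in> K" "norm v \<le> C" for z v
  proof -
    have "C \<ge> 0" using that(2) norm_ge_zero order_trans by blast
    then have "N2 * norm v * norm v \<le> N2 * C * C"
      using that N2(1) by (intro mult_mono) auto
    then show ?thesis using N2(2)[OF that(1), of v v] by linarith
  qed
  have intF: "integrable M (\<lambda>t. F (V t + s *\<^sub>R dV t))" if "s \<in> ?S" for s
  proof (rule integrable_const_bound[where B = N0])
    show "AE t in M. norm (F (V t + s *\<^sub>R dV t)) \<le> N0"
      using VK by eventually_elim (use that N0 in auto)
  qed measurable
  have intG: "integrable M (\<lambda>t. G (V t + s *\<^sub>R dV t) (dV t))" if "s \<in> ?S" for s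
  proof (rule integrable_const_bound[where B = "N1 * C"])
    show "AE t in M. norm (G (V t + s *\<^sub>R dV t) (dV t)) \<le> N1 * C"
      using VK C by eventually_elim (use that G_le in auto)
  qed (rule measurable_along[OF mV dV])
  have D1: "((\<lambda>s. \<integral>t. F (V t + s *\<^sub>R dV t) \<partial>M) has_real_derivative (\<integral>t. G (V t + s *\<^sub>R dV t) (dV t) \<partial>M)) (at s)"
    if "s \<in> ?S" for s
  proof (rule has_real_derivative_lebesgue_integral[where C = "N1 * C", OF _ _ that intF])
    show "(\<lambda>t. G (V t + s *\<^sub>R dV t) (dV t)) \<in> borel_measurable M" by (rule measurable_along[OF mV dV])
    show "AE t in M. \<forall>s\<in>?S. ((\<lambda>s. F (V t + s *\<^sub>R dV t)) has_real_derivative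
             G (V t + s *\<^sub>R dV t) (dV t)) (at s) \<and> \<bar>G (V t + s *\<^sub>R dV t) (dV t)\<bar> \<le> N1 * C"
      using VK C by eventually_elim (use K(2) F_deriv G_le in blast)
  qed auto
  have "((\<lambda>s. \<integral>t. G (V t + s *\<^sub>R dV t) (dV t) \<partial>M) has_real_derivative (\<integral>t. H (V t + 0 *\<^sub>R dV t) (dV t) (dV t) \<partial>M)) (at 0)"
  proof (rule has_real_derivative_lebesgue_integral[where C = "N2 * C * C" and S = ?S, OF _ _ _ intG])
    show "(\<lambda>t. H (V t + 0 *\<^sub>R dV t) (dV t) (dV t)) \<in> borel_measurable M"
      by (rule measurable_along[OF mV dV])
    show "AE t in M. \<forall>s\<in>?S. ((\<lambda>s. G (V t + s *\<^sub>R dV t) (dV t)) has_real_derivative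
             H (V t + s *\<^sub>R dV t) (dV t) (dV t)) (at s) \<and> \<bar>H (V t + s *\<^sub>R dV t) (dV t) (dV t)\<bar> \<le> N2 * C * C"
      using VK C by eventually_elim (use K(2) G_deriv H_le in blast)
  qed (use e in auto)
  then have D2: "((\<lambda>s. \<integral>t. G (V t + s *\<^sub>R dV t) (dV t) \<partial>M) has_real_derivative (\<integral>t. H (V t) (dV t) (dV t) \<partial>M)) (at 0)"
    by simp
  have "(deriv (\<lambda>s. \<integral>t. F (V t + s *\<^sub>R dV t) \<partial>M) has_real_derivative (\<integral>t. H (V t) (dV t) (dV t) \<partial>M)) (at 0)"
  \<comment> \<open>The inner \<open>deriv\<close> is identified with the integral of
    \<open>G\<close> only for \<open>s\<close> in \<open>?S\<close>; the outer derivative at 0 sees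
    nothing beyond this neighbourhood.\<close>
  proof (rule has_field_derivative_transform_within_open[OF D2, where S = ?S])
    show "(\<integral>t. G (V t + s *\<^sub>R dV t) (dV t) \<partial>M) = deriv (\<lambda>s. \<integral>t. F (V t + s *\<^sub>R dV t) \<partial>M) s" if "s \<in> ?S" for s
      by (rule DERIV_imp_deriv[OF D1[OF that], symmetric])
  qed (use e in auto)
  then show ?thesis by (rule DERIV_imp_deriv)
qed

end

section \<open>Essentially bounded functions on the unit interval\<close>

abbreviation I01 :: "real measure" where "I01 \<equiv> lebesgue_on {0..1}"

interpretation I01: finite_measure I01
  by (rule finite_measure_lebesgue_on) simp

lemma measure_I01: "measure I01 (space I01) = 1"
  by (simp add: measure_restrict_space)

lemma integral_const_I01: "(LINT t|I01. c) = (c :: 'a::{banach, second_countable_topology})"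
  using measure_I01 by simp

lemma Linf_spaceI:
  assumes "g \<in> borel_measurable I01" "AE t in I01. norm (g t) \<le> C"
  shows "Linf_space g"
  using assms by (auto simp: Linf_space_def ae01_def)

lemma Linf_spaceE:
  assumes "Linf_space g"
  obtains C where "C \<ge> 0" "g \<in> borel_measurable I01" "AE t in I01. norm (g t) \<le> C"
proof -
  obtain C where C: "AE t in I01. norm (g t) \<le> C" and g: "g \<in> borel_measurable I01"
    using assms by (auto simp: Linf_space_def ae01_def)
  have "AE t in I01. norm (g t) \<le> \<bar>C\<bar>" using C by eventually_elim auto
  then show ?thesis using that[of "\<bar>C\<bar>"] g by auto
qed

lemma Linf_space_measurable: "Linf_space g \<Longrightarrow> g \<in> borel_measurable I01"
  by (simp add: Linf_space_def)

lemma Linf_space_le: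
  fixes f :: "real \<Rightarrow> 'a::real_normed_vector" and g :: "real \<Rightarrow> 'b::real_normed_vector"
  assumes "Linf_space g" "f \<in> borel_measurable I01" "AE t in I01. norm (f t) \<le> K * norm (g t)"
  shows "Linf_space f"
proof -
  obtain C where C: "C \<ge> 0" "AE t in I01. norm (g t) \<le> C" using Linf_spaceE[OF assms(1)] by blast
  have "AE t in I01. norm (f t) \<le> \<bar>K\<bar> * C"
    using C(2) assms(3)
  proof eventually_elim
    case (elim t)
    have "K * norm (g t) \<le> \<bar>K\<bar> * C" using elim C by (intro mult_mono) auto
    then show ?case using elim by linarith
  qed
  with assms(2) show ?thesis by (rule Linf_spaceI)
qed

lemma Linf_space_const: "Linf_space (\<lambda>t. c)"
  by (rule Linf_spaceI[where C = "norm c"]) auto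

lemma Linf_space_add:
  fixes f g :: "real \<Rightarrow> 'a::euclidean_space"
  assumes "Linf_space f" "Linf_space g"
  shows "Linf_space (\<lambda>t. f t + g t)"
proof -
  obtain C where C: "f \<in> borel_measurable I01" "AE t in I01. norm (f t) \<le> C" using Linf_spaceE[OF assms(1)] by blast
  obtain D where D: "g \<in> borel_measurable I01" "AE t in I01. norm (g t) \<le> D" using Linf_spaceE[OF assms(2)] by blast
  have "AE t in I01. norm (f t + g t) \<le> C + D"
    using C(2) D(2) by eventually_elim (rule norm_add_rule_thm)
  then show ?thesis using C(1) D(1) by (intro Linf_spaceI) auto
qed

text \<open>Measurability of the product is a premise because it is not automatic in arbitrary
  normed spaces; the Euclidean instances below supply it.\<close>

lemma (in bounded_bilinear) Linf_space_prod:
  assumes f: "Linf_space f" and g: "Linf_space g"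
    and m: "(\<lambda>t. prod (f t) (g t)) \<in> borel_measurable I01"
  shows "Linf_space (\<lambda>t. prod (f t) (g t))"
proof -
  obtain C where C: "C \<ge> 0" "AE t in I01. norm (f t) \<le> C" using Linf_spaceE[OF f] by blast
  obtain D where D: "D \<ge> 0" "AE t in I01. norm (g t) \<le> D" using Linf_spaceE[OF g] by blast
  obtain K where K: "K \<ge> 0" "\<And>a b. norm (prod a b) \<le> norm a * norm b * K" using nonneg_bounded by blast
  have "AE t in I01. norm (prod (f t) (g t)) \<le> C * D * K"
    using C(2) D(2)
  proof eventually_elim
    case (elim t)
    have "norm (f t) * norm (g t) * K \<le> C * D * K"
      using elim C(1) D(1) K(1) by (intro mult_mono) auto
    then show ?case using K(2)[of "f t" "g t"] by linarith
  qed
  with m show ?thesis by (rule Linf_spaceI)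
qed

lemma Linf_space_inner:
  fixes f g :: "real \<Rightarrow> 'a::euclidean_space"
  assumes "Linf_space f" "Linf_space g"
  shows "Linf_space (\<lambda>t. f t \<bullet> g t)"
  by (rule bounded_bilinear.Linf_space_prod[OF bounded_bilinear_inner assms])
     (intro borel_measurable_inner Linf_space_measurable assms)

lemma Linf_space_scaleR:
  fixes f :: "real \<Rightarrow> real" and g :: "real \<Rightarrow> 'a::euclidean_space"
  assumes "Linf_space f" "Linf_space g"
  shows "Linf_space (\<lambda>t. f t *\<^sub>R g t)"
  by (rule bounded_bilinear.Linf_space_prod[OF bounded_bilinear_scaleR assms])
     (intro borel_measurable_scaleR Linf_space_measurable assms)

lemma Linf_space_diff:
  fixes f g :: "real \<Rightarrow> 'a::euclidean_space"
  assumes "Linf_space f" "Linf_space g"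
  shows "Linf_space (\<lambda>t. f t - g t)"
  using Linf_space_add[OF assms(1) Linf_space_scaleR[OF Linf_space_const assms(2), of "-1"]] by simp

lemma Linf_space_norm:
  assumes "Linf_space f"
  shows "Linf_space (\<lambda>t. norm (f t))"
  by (rule Linf_space_le[OF assms, where K = 1]) (use Linf_space_measurable[OF assms] in auto)

lemma Linf_space_integrable:
  fixes f :: "real \<Rightarrow> 'a::euclidean_space"
  assumes "Linf_space f"
  shows "integrable I01 f"
  using assms by (metis I01.integrable_const_bound Linf_spaceE)

lemma Linf_space_integrable_power2:
  fixes f :: "real \<Rightarrow> 'a::euclidean_space"
  assumes "Linf_space f"
  shows "integrable I01 (\<lambda>t. (norm (f t))\<^sup>2)"
  using Linf_space_integrable[OF Linf_space_inner[OF assms assms]] by (simp add: dot_square_norm)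

lemma continuous_on_Linf_space:
  fixes f :: "real \<Rightarrow> 'a::euclidean_space"
  assumes "continuous_on {0..1} f"
  shows "Linf_space f"
proof -
  have "bounded (f ` {0..1})"
    by (intro compact_imp_bounded compact_continuous_image assms compact_Icc)
  then obtain C where "\<forall>y \<in> f ` {0..1}. norm y \<le> C"
    unfolding bounded_iff ..
  moreover have "f \<in> borel_measurable I01"
    using assms by (rule continuous_imp_measurable_on_sets_lebesgue) auto
  ultimately show ?thesis
    by (intro Linf_spaceI[where C = C]) (auto intro!: AE_I2)
qed

lemma Linf_nonneg:
  assumes "Linf_space g" shows "Linf g \<ge> 0"
  unfolding Linf_def ae01_def
  using Linf_spaceE[OF assms] by (intro cInf_greatest) blast+

text \<open>The infimum is attained: the countably many thresholds \<open>Linf g + 1/(n+1)\<close>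
  involve only countably many null sets.\<close>

lemma AE_norm_le_Linf:
  assumes "Linf_space g" shows "AE t in I01. norm (g t) \<le> Linf g"
proof -
  let ?S = "{C. C \<ge> 0 \<and> ae01 (\<lambda>t. norm (g t) \<le> C)}"
  have ne: "?S \<noteq> {}" using Linf_spaceE[OF assms] unfolding ae01_def by blast
  have "AE t in I01. norm (g t) \<le> Linf g + inverse (real (Suc n))" for n
  proof -
    have "Inf ?S < Linf g + inverse (real (Suc n))" unfolding Linf_def by (simp del: of_nat_Suc)
    from cInf_lessD[OF ne this] obtain C where "AE t in I01. norm (g t) \<le> C" "C < Linf g + inverse (real (Suc n))"
      by (auto simp: ae01_def)
    then show ?thesis by (auto elim: eventually_mono)
  qed
  then have "AE t in I01. \<forall>n. norm (g t) \<le> Linf g + inverse (real (Suc n))"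
    by (subst AE_all_countable) blast
  then show ?thesis
  proof eventually_elim
    case (elim t)
    have "(\<lambda>n. Linf g + inverse (real (Suc n))) \<longlonglongrightarrow> Linf g + 0"
      by (intro tendsto_intros LIMSEQ_inverse_real_of_nat)
    then show ?case using elim by (intro LIMSEQ_le_const[where X = "\<lambda>n. Linf g + inverse (real (Suc n))"]) auto
  qed
qed

section \<open>The L2 norm of bounded functions\<close>

lemma L2norm_nonneg: "L2norm f \<ge> 0"
  by (auto simp: L2norm_def intro!: integral_nonneg_AE)

lemma L2norm_power2: "(L2norm f)\<^sup>2 = (LINT t|I01. (norm (f t))\<^sup>2)"
  by (auto simp: L2norm_def intro!: integral_nonneg_AE)

lemma L2norm_mono:
  fixes f :: "real \<Rightarrow> 'a::euclidean_space" and g :: "real \<Rightarrow> 'b::euclidean_space"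
  assumes "Linf_space f" "Linf_space g" "AE t in I01. norm (f t) \<le> norm (g t)"
  shows "L2norm f \<le> L2norm g"
  unfolding L2norm_def
proof (intro real_sqrt_le_mono integral_mono_AE Linf_space_integrable_power2 assms(1,2))
  show "AE t in I01. (norm (f t))\<^sup>2 \<le> (norm (g t))\<^sup>2"
    using assms(3) by eventually_elim (simp add: power_mono)
qed

lemma L2norm_const: "L2norm (\<lambda>t. c :: 'a::euclidean_space) = norm c"
  by (simp add: L2norm_def measure_I01[simplified])

lemma L2norm_scaleR: "L2norm (\<lambda>t. c *\<^sub>R f t) = \<bar>c\<bar> * L2norm f"
  by (simp add: L2norm_def power_mult_distrib real_sqrt_mult)

lemma norm_add_power2_le:
  fixes x y :: "'a::real_inner"
  assumes "\<theta> > 0"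
  shows "(norm (x + y))\<^sup>2 \<le> (1 + \<theta>) * (norm x)\<^sup>2 + (1 + 1 / \<theta>) * (norm y)\<^sup>2"
proof -
  have "0 \<le> (norm (\<theta> *\<^sub>R x - y))\<^sup>2 / \<theta>" using assms by simp
  also have "\<dots> = \<theta> * (norm x)\<^sup>2 - 2 * (x \<bullet> y) + (norm y)\<^sup>2 / \<theta>"
    using assms by (simp add: power2_norm_eq_inner inner_diff inner_commute field_simps)
  finally show ?thesis
    by (simp add: power2_norm_eq_inner inner_add inner_commute field_simps)
qed

text \<open>Minkowski's inequality, derived from the weighted Young inequality with the best
  constant weight.\<close>

lemma L2norm_triangle:
  fixes f g :: "real \<Rightarrow> 'a::euclidean_space"
  assumes f: "Linf_space f" and g: "Linf_space g"
  shows "L2norm (\<lambda>t. f t + g t) \<le> L2norm f + L2norm g"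
proof (rule field_le_epsilon)
  fix e :: real assume e: "e > 0"
  \<comment> \<open>The padding by \<open>e / 2\<close> makes both numbers positive, so the weight
    \<open>b / a\<close> is defined. With it the right-hand side collapses to
    \<open>(a + b)^2\<close>.\<close>
  define a b where "a = L2norm f + e / 2" and "b = L2norm g + e / 2"
  have ab: "a > 0" "b > 0" using e L2norm_nonneg[of f] L2norm_nonneg[of g] by (auto simp: a_def b_def)
  note i = Linf_space_integrable_power2
  have "(L2norm (\<lambda>t. f t + g t))\<^sup>2
      \<le> (LINT t|I01. (1 + b / a) * (norm (f t))\<^sup>2 + (1 + 1 / (b / a)) * (norm (g t))\<^sup>2)"
    unfolding L2norm_power2
    using ab by (intro integral_mono norm_add_power2_le i Linf_space_add f g Bochner_Integration.integrable_add integrable_mult_right) auto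
  also have "\<dots> = (1 + b / a) * (L2norm f)\<^sup>2 + (1 + a / b) * (L2norm g)\<^sup>2"
    using i[OF f] i[OF g] by (simp add: L2norm_power2)
  also have "\<dots> \<le> (1 + b / a) * a\<^sup>2 + (1 + a / b) * b\<^sup>2"
    using ab e L2norm_nonneg[of f] L2norm_nonneg[of g]
    by (intro add_mono mult_left_mono power_mono) (auto simp: a_def b_def)
  also have "\<dots> = (a + b)\<^sup>2"
    using ab by (simp add: distrib_right power2_eq_square algebra_simps)
  finally have "L2norm (\<lambda>t. f t + g t) \<le> a + b"
    by (rule power2_le_imp_le) (use ab in simp)
  then show "L2norm (\<lambda>t. f t + g t) \<le> L2norm f + L2norm g + e"
    by (simp add: a_def b_def)
qed

lemma L2norm_le_affine:
  fixes f :: "real \<Rightarrow> 'a::euclidean_space" and g :: "real \<Rightarrow> 'b::euclidean_space"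
  assumes f: "Linf_space f" and g: "Linf_space g" and "a \<ge> 0" "b \<ge> 0"
    and le: "AE t in I01. norm (f t) \<le> a * norm (g t) + b"
  shows "L2norm f \<le> a * L2norm g + b"
proof -
  have 1: "Linf_space (\<lambda>t. a *\<^sub>R norm (g t))" by (intro Linf_space_scaleR Linf_space_const Linf_space_norm g)
  have "L2norm f \<le> L2norm (\<lambda>t. a *\<^sub>R norm (g t) + b)"
    using le assms by (intro L2norm_mono f Linf_space_add 1 Linf_space_const) (auto elim!: eventually_mono)
  also have "\<dots> \<le> L2norm (\<lambda>t. a *\<^sub>R norm (g t)) + L2norm (\<lambda>t. b)"
    by (intro L2norm_triangle 1 Linf_space_const)
  also have "\<dots> = a * L2norm (\<lambda>t. norm (g t)) + b"
    using assms by (simp only: L2norm_scaleR L2norm_const) simp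
  also have "L2norm (\<lambda>t. norm (g t)) = L2norm g" by (simp add: L2norm_def)
  finally show ?thesis .
qed

text \<open>On a space of total mass one this is the nonnegativity of the variance of
  \<open>norm (g t)\<close>.\<close>

lemma integral_norm_le_L2norm:
  fixes g :: "real \<Rightarrow> 'a::euclidean_space"
  assumes g: "Linf_space g"
  shows "(LINT t|I01. norm (g t)) \<le> L2norm g"
proof -
  define c where "c = (LINT t|I01. norm (g t))"
  have i1: "integrable I01 (\<lambda>t. norm (g t))" by (intro Linf_space_integrable Linf_space_norm g)
  note i2 = Linf_space_integrable_power2[OF g]
  have "0 \<le> (LINT t|I01. (norm (g t) - c)\<^sup>2)" by simp
  also have "\<dots> = (LINT t|I01. (norm (g t))\<^sup>2 - 2 * c * norm (g t) + c\<^sup>2)"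
    by (simp add: power2_diff algebra_simps)
  also have "\<dots> = (LINT t|I01. (norm (g t))\<^sup>2) - 2 * c * (LINT t|I01. norm (g t)) + (LINT t|I01. c\<^sup>2)"
    using i1 i2 by simp
  also have "(LINT t|I01. c\<^sup>2) = c\<^sup>2" by (rule integral_const_I01)
  finally have "0 \<le> (L2norm g)\<^sup>2 - 2 * c * c + c\<^sup>2"
    by (simp only: L2norm_power2 c_def[symmetric])
  then have "c\<^sup>2 \<le> (L2norm g)\<^sup>2"
    by (simp add: power2_eq_square)
  then show ?thesis
    unfolding c_def by (rule power2_le_imp_le) (rule L2norm_nonneg)
qed

section \<open>Lipschitz curves and the direction space\<close>

lemma Linf_space_integrable_on:
  fixes g :: "real \<Rightarrow> 'a::euclidean_space"
  assumes "Linf_space g" "t \<in> {0..1}"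
  shows "g integrable_on {0..t}"
proof -
  have "g integrable_on {0..1}"
    by (rule integrable_on_lebesgue_on[OF Linf_space_integrable[OF assms(1)]]) simp
  then show ?thesis
    by (rule integrable_on_subinterval) (use assms in auto)
qed

text \<open>Bridge between the gauge integral in \<open>W1inf\<close> and the Lebesgue integral in
  the norms and functionals.\<close>

lemma integral_I01_eq:
  fixes g :: "real \<Rightarrow> 'a::euclidean_space"
  assumes "Linf_space g"
  shows "(LINT t|I01. g t) = integral {0..1} g"
  by (rule lebesgue_integral_eq_integral[OF Linf_space_integrable[OF assms]]) simp

lemma W1inf_norm_diff_le:
  assumes W: "W1inf \<xi> \<xi>'" and t: "t \<in> {0..1}"
  shows "norm (\<xi> t - \<xi> 0) \<le> (LINT t|I01. norm (\<xi>' t))"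
proof -
  have L: "Linf_space \<xi>'" using W by (simp add: W1inf_def)
  have "\<xi> t - \<xi> 0 = integral {0..t} \<xi>'" using W t by (metis W1inf_def integral_unique)
  also have "norm \<dots> \<le> integral {0..t} (\<lambda>t. norm (\<xi>' t))"
    using t by (intro Henstock_Kurzweil_Integration.integral_norm_bound_integral Linf_space_integrable_on Linf_space_norm L) auto
  also have "\<dots> \<le> integral {0..1} (\<lambda>t. norm (\<xi>' t))"
    using t by (intro integral_subset_le Linf_space_integrable_on Linf_space_norm L) auto
  also have "\<dots> = (LINT t|I01. norm (\<xi>' t))"
    by (rule integral_I01_eq[symmetric]) (intro Linf_space_norm L)
  finally show ?thesis .
qed

lemma W1inf_continuous_on:
  assumes W: "W1inf \<xi> \<xi>'" shows "continuous_on {0..1} \<xi>"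
proof -
  have "continuous_on {0..1} (\<lambda>t. \<xi> 0 + integral {0..t} \<xi>')"
    using W by (intro continuous_intros indefinite_integral_continuous_1 Linf_space_integrable_on) (auto simp: W1inf_def)
  then show ?thesis
  proof (rule continuous_on_eq)
    fix t :: real assume "t \<in> {0..1}"
    then have "integral {0..t} \<xi>' = \<xi> t - \<xi> 0" using W by (metis W1inf_def integral_unique)
    then show "\<xi> 0 + integral {0..t} \<xi>' = \<xi> t" by simp
  qed
qed

lemma W1inf_Linf_space:
  assumes "W1inf \<xi> \<xi>'" shows "Linf_space \<xi>" "Linf_space \<xi>'"
  using assms continuous_on_Linf_space[OF W1inf_continuous_on[OF assms]] by (auto simp: W1inf_def)

lemma W1inf_integral:
  assumes "W1inf \<xi> \<xi>'" shows "(LINT t|I01. \<xi>' t) = \<xi> 1 - \<xi> 0"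
proof -
  have "(\<xi>' has_integral (\<xi> 1 - \<xi> 0)) {0..1}" using assms by (simp add: W1inf_def)
  then show ?thesis by (simp add: integral_I01_eq[OF W1inf_Linf_space(2)[OF assms]] integral_unique)
qed

lemma W1inf_diff:
  assumes "W1inf \<xi> \<xi>'" "W1inf \<eta> \<eta>'" shows "W1inf (\<lambda>t. \<xi> t - \<eta> t) (\<lambda>t. \<xi>' t - \<eta>' t)"
  unfolding W1inf_def
proof (intro conjI ballI)
  show "Linf_space (\<lambda>t. \<xi>' t - \<eta>' t)"
    using assms by (intro Linf_space_diff) (auto simp: W1inf_def)
  fix t :: real assume "t \<in> {0..1}"
  then have "((\<lambda>t. \<xi>' t - \<eta>' t) has_integral (\<xi> t - \<xi> 0) - (\<eta> t - \<eta> 0)) {0..t}"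
    using assms by (intro has_integral_diff) (auto simp: W1inf_def)
  then show "((\<lambda>t. \<xi>' t - \<eta>' t) has_integral \<xi> t - \<eta> t - (\<xi> 0 - \<eta> 0)) {0..t}"
    by (simp add: algebra_simps)
qed

lemma W1inf_indefinite_integral:
  assumes "Linf_space g" shows "W1inf (\<lambda>t. integral {0..t} g) g"
  unfolding W1inf_def using assms Linf_space_integrable_on[OF assms] integrable_integral by auto

lemma Z2norm_triangle:
  assumes "(dL, \<xi>, \<xi>') \<in> dZset" "(m, \<eta>, \<eta>') \<in> dZset"
  shows "Z2norm dL \<xi> \<xi>' \<le> Z2norm (dL - m) (\<lambda>t. \<xi> t - \<eta> t) (\<lambda>t. \<xi>' t - \<eta>' t) + Z2norm m \<eta> \<eta>'"
proof -
  have W: "W1inf \<xi> \<xi>'" "W1inf \<eta> \<eta>'" using assms by (auto simp: dZset_def)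
  note L = W1inf_Linf_space[OF W(1)] W1inf_Linf_space[OF W(2)]
  have "L2norm \<xi> \<le> L2norm (\<lambda>t. \<xi> t - \<eta> t) + L2norm \<eta>"
    using L2norm_triangle[OF Linf_space_diff[OF L(1,3)] L(3)] by simp
  moreover have "L2norm \<xi>' \<le> L2norm (\<lambda>t. \<xi>' t - \<eta>' t) + L2norm \<eta>'"
    using L2norm_triangle[OF Linf_space_diff[OF L(2,4)] L(4)] by simp
  ultimately show ?thesis unfolding Z2norm_def by linarith
qed

lemma Z2norm_nonneg: "Z2norm dL \<xi> \<xi>' \<ge> 0"
  by (simp add: Z2norm_def L2norm_nonneg)

text \<open>\<open>Z2norm\<close> is a sum of norms, so its square has nonnegative cross terms on
  top of the three squares.\<close>

lemma integral_norm_power2_le_Z2norm: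
  assumes "(dL, \<xi>, \<xi>') \<in> dZset"
  shows "(LINT t|I01. (norm (\<xi> t, \<xi>' t))\<^sup>2) + dL\<^sup>2 \<le> (Z2norm dL \<xi> \<xi>')\<^sup>2"
proof -
  have W: "W1inf \<xi> \<xi>'" using assms by (auto simp: dZset_def)
  note L = W1inf_Linf_space[OF W]
  have "(LINT t|I01. (norm (\<xi> t, \<xi>' t))\<^sup>2) = (L2norm \<xi>)\<^sup>2 + (L2norm \<xi>')\<^sup>2"
    using L[THEN Linf_space_integrable_power2] by (simp add: norm_Pair L2norm_power2)
  moreover have "(L2norm \<xi>)\<^sup>2 + (L2norm \<xi>')\<^sup>2 + dL\<^sup>2 \<le> (\<bar>dL\<bar> + L2norm \<xi> + L2norm \<xi>')\<^sup>2"
    using L2norm_nonneg[of \<xi>] L2norm_nonneg[of \<xi>'] by (simp add: power2_sum)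
  ultimately show ?thesis by (simp add: Z2norm_def)
qed

section \<open>A right inverse of the linearised constraint\<close>

text \<open>The correction \<open>\<eta>'\<close> is the sum of the multiple of \<open>\<xi>'\<close> prescribed by the constraint and the
  component orthogonal to \<open>\<xi>'\<close> of a constant vector \<open>u\<close>.  The requirement that \<open>\<eta>'\<close> has integral zero
  is a linear equation \<open>A u = - v\<close>, and \<open>A u \<bullet> u = 0\<close> forces \<open>\<xi>'\<close> to be parallel to \<open>u\<close> and
  \<open>x\<^sub>D - x\<^sub>O\<close> to be orthogonal to \<open>u\<close>, hence \<open>u = 0\<close>.\<close>

lemma constraint_right_inverse:
  fixes \<xi> \<xi>' :: "real \<Rightarrow> pt" and L :: real
  assumes W: "W1inf \<xi> \<xi>'" and ne: "\<xi> 0 \<noteq> \<xi> 1"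
    and sp: "AE t in I01. (norm (\<xi>' t))\<^sup>2 = L\<^sup>2"
  shows "\<exists>C\<ge>0. \<forall>r. Linf_space r \<longrightarrow> (\<exists>m \<eta> \<eta>'. (m, \<eta>, \<eta>') \<in> dZset \<and>
      (AE t in I01. \<xi>' t \<bullet> \<eta>' t = r t + L * m) \<and> Z2norm m \<eta> \<eta>' \<le> C * L2norm r)"
proof -
  define \<Delta> where "\<Delta> = \<xi> 1 - \<xi> 0"
  have \<Delta>: "\<Delta> \<noteq> 0" using ne by (simp add: \<Delta>_def)
  note L' = W1inf_Linf_space(2)[OF W]
  note int\<xi>' = Linf_space_integrable[OF L']
  have int\<Delta>: "(LINT t|I01. \<xi>' t) = \<Delta>" using W1inf_integral[OF W] by (simp add: \<Delta>_def)
  have spn: "AE t in I01. norm (\<xi>' t) = \<bar>L\<bar>"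
    using sp by eventually_elim (metis real_sqrt_abs abs_norm_cancel)
  have L0: "L \<noteq> 0"
  proof
    assume "L = 0"
    then have "AE t in I01. \<xi>' t = 0" using sp by simp
    then have "(LINT t|I01. \<xi>' t) = 0" by (rule integral_eq_zero_AE)
    then show False using \<Delta> int\<Delta> by simp
  qed
  \<comment> \<open>\<open>L^2\<close> times the component of \<open>u\<close> orthogonal to
    \<open>\<xi>' t\<close>, since the squared speed is \<open>L^2\<close>. The scaling avoids a
    division.\<close>
  define p where "p u t = (L\<^sup>2) *\<^sub>R u - (\<xi>' t \<bullet> u) *\<^sub>R \<xi>' t" for u t
  have Lp: "Linf_space (p u)" for u
    unfolding p_def by (intro Linf_space_diff Linf_space_const Linf_space_scaleR Linf_space_inner L')
  \<comment> \<open>The first summand is the integral of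
    \<open>(\<Delta> \<bullet> u) *\<^sub>R \<xi>' t\<close> and exists thanks to the freedom in
    \<open>m\<close>. On a straight line the orthogonal components never reach the direction
    \<Delta>; this summand does, and \<open>A\<close> becomes positive definite.\<close>
  define A where "A u = (\<Delta> \<bullet> u) *\<^sub>R \<Delta> + (LINT t|I01. p u t)" for u
  have p_orth: "AE t in I01. \<forall>u. \<xi>' t \<bullet> p u t = 0"
    using sp by eventually_elim (simp add: p_def inner_diff power2_norm_eq_inner inner_commute)
  have p_le: "AE t in I01. \<forall>u. norm (p u t) \<le> 2 * L\<^sup>2 * norm u"
    using spn
  proof eventually_elim
    case (elim t)
    show ?case
    proof
      fix u
      have "norm (p u t) \<le> L\<^sup>2 * norm u + \<bar>\<xi>' t \<bullet> u\<bar> * norm (\<xi>' t)"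
        unfolding p_def by (rule order_trans[OF norm_triangle_ineq4]) simp
      also have "\<bar>\<xi>' t \<bullet> u\<bar> * norm (\<xi>' t) \<le> (\<bar>L\<bar> * norm u) * \<bar>L\<bar>"
        using Cauchy_Schwarz_ineq2[of "\<xi>' t" u] elim by (intro mult_mono) auto
      also have "(\<bar>L\<bar> * norm u) * \<bar>L\<bar> = L\<^sup>2 * norm u" by (simp add: power2_eq_square)
      finally show "norm (p u t) \<le> 2 * L\<^sup>2 * norm u" by (simp add: mult_ac)
    qed
  qed
  have p_inner: "p u t \<bullet> u = L\<^sup>2 * (norm u)\<^sup>2 - (\<xi>' t \<bullet> u)\<^sup>2" for u t
    by (simp add: p_def inner_diff power2_norm_eq_inner) (simp add: inner_commute power2_eq_square)
  have p_nonneg: "AE t in I01. \<forall>u. p u t \<bullet> u \<ge> 0"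
    using spn
  proof eventually_elim
    case (elim t)
    show ?case
    proof
      fix u
      have "(\<xi>' t \<bullet> u)\<^sup>2 \<le> (norm (\<xi>' t) * norm u)\<^sup>2"
        using Cauchy_Schwarz_ineq2[of "\<xi>' t" u] by (metis abs_le_square_iff abs_mult abs_norm_cancel)
      then show "p u t \<bullet> u \<ge> 0" unfolding p_inner using elim by (simp add: power_mult_distrib)
    qed
  qed
  have A_lin: "linear A"
  proof (rule linearI)
    fix u v :: pt and c :: real
    have "(LINT t|I01. p (u + v) t) = (LINT t|I01. p u t + p v t)"
      by (simp add: p_def algebra_simps inner_add scaleR_add_left scaleR_add_right)
    also have "\<dots> = (LINT t|I01. p u t) + (LINT t|I01. p v t)"
      by (intro Bochner_Integration.integral_add Linf_space_integrable Lp)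
    finally show "A (u + v) = A u + A v"
      by (simp add: A_def inner_add scaleR_add_left)
    have "(LINT t|I01. p (c *\<^sub>R u) t) = (LINT t|I01. c *\<^sub>R p u t)"
      by (simp add: p_def algebra_simps)
    also have "\<dots> = c *\<^sub>R (LINT t|I01. p u t)" by simp
    finally show "A (c *\<^sub>R u) = c *\<^sub>R A u"
      by (simp add: A_def algebra_simps)
  qed
  have A0: "u = 0" if "A u = 0" for u
  proof (rule ccontr)
    assume u: "u \<noteq> 0"
    have Lpu: "Linf_space (\<lambda>t. p u t \<bullet> u)" by (intro Linf_space_inner Lp Linf_space_const)
    have "0 = A u \<bullet> u" using that by simp
    also have "\<dots> = (\<Delta> \<bullet> u)\<^sup>2 + (LINT t|I01. p u t \<bullet> u)"
      using Linf_space_integrable[OF Lp[of u]] by (simp add: A_def inner_add power2_eq_square)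
    finally have eq: "0 = (\<Delta> \<bullet> u)\<^sup>2 + (LINT t|I01. p u t \<bullet> u)" .
    have ge: "(LINT t|I01. p u t \<bullet> u) \<ge> 0"
      using p_nonneg by (intro integral_nonneg_AE) (auto elim: eventually_mono)
    have "(\<Delta> \<bullet> u)\<^sup>2 = 0" "(LINT t|I01. p u t \<bullet> u) = 0" using eq ge zero_le_power2[of "\<Delta> \<bullet> u"] by linarith+
    then have \<Delta>u: "\<Delta> \<bullet> u = 0" by simp
    have "AE t in I01. 0 \<le> p u t \<bullet> u"
      using p_nonneg by eventually_elim blast
    then have "AE t in I01. p u t \<bullet> u = 0"
      using \<open>(LINT t|I01. p u t \<bullet> u) = 0\<close> integral_nonneg_eq_0_iff_AE[OF Linf_space_integrable[OF Lpu]]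
      by blast
    \<comment> \<open>\<open>p u t \<bullet> u = 0\<close> is the equality case of Cauchy-Schwarz;
      the residual \<open>?q\<close> of the projection onto \<open>u\<close> then has norm
      zero.\<close>
    then have "AE t in I01. \<xi>' t = ((\<xi>' t \<bullet> u) / (norm u)\<^sup>2) *\<^sub>R u"
      using sp
    proof eventually_elim
      case (elim t)
      have e: "(\<xi>' t \<bullet> u)\<^sup>2 = (norm (\<xi>' t))\<^sup>2 * (norm u)\<^sup>2" using elim p_inner[of u t] by simp
      let ?q = "\<xi>' t - ((\<xi>' t \<bullet> u) / (norm u)\<^sup>2) *\<^sub>R u"
      have "?q \<bullet> ?q = \<xi>' t \<bullet> \<xi>' t - (\<xi>' t \<bullet> u)\<^sup>2 / (norm u)\<^sup>2"
        using u by (simp add: inner_diff inner_commute dot_square_norm[of u] power2_eq_square)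
      also have "\<dots> = 0" using u unfolding e by (simp add: power2_norm_eq_inner)
      finally show ?case by simp
    qed
    then have "(LINT t|I01. \<xi>' t) = (LINT t|I01. ((\<xi>' t \<bullet> u) / (norm u)\<^sup>2) *\<^sub>R u)"
      using int\<xi>' by (intro integral_cong_AE) auto
    also have "\<dots> = ((\<Delta> \<bullet> u) / (norm u)\<^sup>2) *\<^sub>R u"
      using int\<xi>' by (simp add: int\<Delta>)
    finally show False using \<Delta>u \<Delta> int\<Delta> by simp
  qed
  have A_inj: "inj A" using A_lin A0 linear_injective_0 by blast
  have A_surj: "surj A" using A_lin A_inj by (rule linear_injective_imp_surjective) (rule refl)
  obtain b where b: "b > 0" "\<And>u. b * norm u \<le> norm (A u)"
    using linear_inj_bounded_below_pos[OF A_lin A_inj] by blast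
  \<comment> \<open>The part of \<open>\<eta>'\<close> that depends on \<open>u\<close> is at most
    \<open>(norm \<Delta> * \<bar>L\<bar> + 2 * L^2) * norm u\<close>, and \<open>norm u\<close> is
    at most \<open>L2norm r / (b * \<bar>L\<bar>)\<close>.\<close>
  define k where "k = (norm \<Delta> * \<bar>L\<bar> + 2 * L\<^sup>2) / (b * \<bar>L\<bar>)"
  have k0: "k \<ge> 0" using b(1) by (simp add: k_def)
  \<comment> \<open>The first term pays for \<open>m\<close>. The bound for \<open>\<eta>'\<close>
    is counted twice, because it also bounds \<open>\<eta>\<close> pointwise through
    integration.\<close>
  define C where "C = norm \<Delta> / b + 2 * (1 / \<bar>L\<bar> + k)"
  have C0: "C \<ge> 0" using b(1) k0 by (simp add: C_def)
  have "\<exists>m \<eta> \<eta>'. (m, \<eta>, \<eta>') \<in> dZset \<and>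
      (AE t in I01. \<xi>' t \<bullet> \<eta>' t = r t + L * m) \<and> Z2norm m \<eta> \<eta>' \<le> C * L2norm r" if r: "Linf_space r" for r :: "real \<Rightarrow> real"
  proof -
    define v where "v = (LINT t|I01. (r t / L\<^sup>2) *\<^sub>R \<xi>' t)"
    have Lv: "Linf_space (\<lambda>t. (r t / L\<^sup>2) *\<^sub>R \<xi>' t)"
      using Linf_space_scaleR[OF Linf_space_scaleR[OF Linf_space_const r, of "1 / L\<^sup>2"] L'] by simp
    obtain u where u: "A u = - v" using A_surj by (metis surjD)
    \<comment> \<open>The coefficient of \<open>\<xi>'\<close> in \<open>\<eta>'\<close> is
      \<open>r t / L^2 + \<Delta> \<bullet> u\<close>. Its product with the squared speed must be
      \<open>r t + L * m\<close>, which dictates this \<open>m\<close>.\<close>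
    define m where "m = L * (\<Delta> \<bullet> u)"
    define \<eta>' where "\<eta>' t = (r t / L\<^sup>2) *\<^sub>R \<xi>' t + ((\<Delta> \<bullet> u) *\<^sub>R \<xi>' t + p u t)" for t
    define \<eta> where "\<eta> t = integral {0..t} \<eta>'" for t
    have L2: "Linf_space (\<lambda>t. (\<Delta> \<bullet> u) *\<^sub>R \<xi>' t + p u t)"
      by (intro Linf_space_add Linf_space_scaleR Linf_space_const Lp L')
    have L\<eta>': "Linf_space \<eta>'"
      unfolding \<eta>'_def by (intro Linf_space_add Lv L2)
    have W\<eta>: "W1inf \<eta> \<eta>'" unfolding \<eta>_def by (rule W1inf_indefinite_integral[OF L\<eta>'])
    have "(LINT t|I01. \<eta>' t) = v + (LINT t|I01. (\<Delta> \<bullet> u) *\<^sub>R \<xi>' t + p u t)"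
      unfolding \<eta>'_def v_def by (intro Bochner_Integration.integral_add Linf_space_integrable Lv L2)
    also have "(LINT t|I01. (\<Delta> \<bullet> u) *\<^sub>R \<xi>' t + p u t) = A u"
      unfolding A_def using int\<xi>' Linf_space_integrable[OF Lp] by (simp add: int\<Delta>)
    finally have "(LINT t|I01. \<eta>' t) = 0" using u by simp
    then have "\<eta> 1 = 0" unfolding \<eta>_def using integral_I01_eq[OF L\<eta>'] by simp
    then have Z: "(m, \<eta>, \<eta>') \<in> dZset" using W\<eta> by (simp add: dZset_def \<eta>_def)
    have con: "AE t in I01. \<xi>' t \<bullet> \<eta>' t = r t + L * m"
      using sp p_orth
    proof eventually_elim
      case (elim t)
      have "\<xi>' t \<bullet> \<eta>' t = (r t / L\<^sup>2) * (\<xi>' t \<bullet> \<xi>' t) + (\<Delta> \<bullet> u) * (\<xi>' t \<bullet> \<xi>' t)"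
        using elim by (simp add: \<eta>'_def inner_add)
      also have "\<xi>' t \<bullet> \<xi>' t = L\<^sup>2" using elim by (simp add: power2_norm_eq_inner)
      finally show ?case using L0 by (simp add: m_def power2_eq_square)
    qed
    define \<rho> where "\<rho> = L2norm r"
    have \<rho>0: "\<rho> \<ge> 0" by (simp add: \<rho>_def L2norm_nonneg)
    have rn: "AE t in I01. norm ((r t / L\<^sup>2) *\<^sub>R \<xi>' t) = norm (r t) / \<bar>L\<bar>"
      using spn by eventually_elim (use L0 in \<open>simp add: frac_eq_eq power2_eq_square abs_mult mult.assoc\<close>)
    have "norm v \<le> (LINT t|I01. norm ((r t / L\<^sup>2) *\<^sub>R \<xi>' t))" unfolding v_def by (rule integral_norm_bound)
    also have "\<dots> = (LINT t|I01. norm (r t) / \<bar>L\<bar>)"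
      using Linf_space_measurable[OF Linf_space_norm[OF Lv]] Linf_space_measurable[OF Linf_space_norm[OF r]] rn
      by (intro integral_cong_AE borel_measurable_divide borel_measurable_const)
    also have "\<dots> = (LINT t|I01. norm (r t)) / \<bar>L\<bar>" by simp
    also have "\<dots> \<le> \<rho> / \<bar>L\<bar>" unfolding \<rho>_def by (intro divide_right_mono integral_norm_le_L2norm r) simp
    finally have "norm v \<le> \<rho> / \<bar>L\<bar>" .
    then have "b * norm u \<le> \<rho> / \<bar>L\<bar>" using b(2)[of u] u by simp
    then have "norm u \<le> \<rho> / \<bar>L\<bar> / b" using b(1) by (simp only: pos_le_divide_eq mult.commute)
    then have un: "norm u \<le> \<rho> / (b * \<bar>L\<bar>)" by (simp add: mult.commute)
    have \<Delta>un: "\<bar>\<Delta> \<bullet> u\<bar> \<le> norm \<Delta> * (\<rho> / (b * \<bar>L\<bar>))"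
      using order_trans[OF Cauchy_Schwarz_ineq2 mult_left_mono[OF un]] by simp
    have mb: "\<bar>m\<bar> \<le> (norm \<Delta> / b) * \<rho>"
      using L0 mult_left_mono[OF \<Delta>un, of "\<bar>L\<bar>"] by (simp add: m_def abs_mult mult_ac)
    have "AE t in I01. norm (\<eta>' t) \<le> (1 / \<bar>L\<bar>) * norm (r t) + k * \<rho>"
      using rn spn p_le
    proof eventually_elim
      case (elim t)
      have "norm (\<eta>' t) \<le> norm ((r t / L\<^sup>2) *\<^sub>R \<xi>' t) + (norm ((\<Delta> \<bullet> u) *\<^sub>R \<xi>' t) + norm (p u t))"
        unfolding \<eta>'_def by (intro norm_triangle_le add_left_mono norm_triangle_ineq)
      moreover have "norm ((\<Delta> \<bullet> u) *\<^sub>R \<xi>' t) \<le> norm \<Delta> * (\<rho> / (b * \<bar>L\<bar>)) * \<bar>L\<bar>"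
        using elim mult_right_mono[OF \<Delta>un, of "\<bar>L\<bar>"] by simp
      moreover have "norm (p u t) \<le> 2 * L\<^sup>2 * (\<rho> / (b * \<bar>L\<bar>))"
        using elim mult_left_mono[OF un, of "2 * L\<^sup>2"] by (auto intro: order_trans)
      moreover have "norm \<Delta> * (\<rho> / (b * \<bar>L\<bar>)) * \<bar>L\<bar> + 2 * L\<^sup>2 * (\<rho> / (b * \<bar>L\<bar>)) = k * \<rho>"
        by (simp add: k_def add_divide_distrib algebra_simps)
      moreover have "norm ((r t / L\<^sup>2) *\<^sub>R \<xi>' t) = (1 / \<bar>L\<bar>) * norm (r t)" using elim by simp
      ultimately show ?case by linarith
    qed
    then have "L2norm \<eta>' \<le> (1 / \<bar>L\<bar>) * L2norm r + k * \<rho>"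
      using k0 \<rho>0 by (intro L2norm_le_affine L\<eta>' r) auto
    then have \<eta>'b: "L2norm \<eta>' \<le> (1 / \<bar>L\<bar> + k) * \<rho>" by (simp add: \<rho>_def algebra_simps)
    have "norm (\<eta> t) \<le> (1 / \<bar>L\<bar> + k) * \<rho>" if "t \<in> {0..1}" for t
      using W1inf_norm_diff_le[OF W\<eta> that] integral_norm_le_L2norm[OF L\<eta>'] \<eta>'b by (simp add: \<eta>_def)
    \<comment> \<open>The vanishing term only gives the bound the shape that
      \<open>L2norm_le_affine\<close> expects.\<close>
    then have "AE t in I01. norm (\<eta> t) \<le> 0 * norm (\<eta> t) + (1 / \<bar>L\<bar> + k) * \<rho>"
      by (intro AE_I2) auto
    then have "L2norm \<eta> \<le> 0 * L2norm \<eta> + (1 / \<bar>L\<bar> + k) * \<rho>"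
      using k0 \<rho>0 by (intro L2norm_le_affine W1inf_Linf_space[OF W\<eta>]) auto
    moreover have "C * \<rho> = norm \<Delta> / b * \<rho> + 2 * ((1 / \<bar>L\<bar> + k) * \<rho>)"
      unfolding C_def by (simp only: distrib_right mult.assoc)
    ultimately have "Z2norm m \<eta> \<eta>' \<le> C * \<rho>"
      using mb \<eta>'b by (simp add: Z2norm_def)
    then show ?thesis using Z con unfolding \<rho>_def by blast
  qed
  then show ?thesis using C0 by blast
qed

section \<open>Coercivity near the optimum\<close>

text \<open>The cost remains continuous at \<open>p = 0\<close>, although it is not differentiable
  there. Global measurability lets it be composed with velocities that are nonzero only almost
  everywhere.\<close>

lemma fcost_measurable:
  fixes w :: "pt \<Rightarrow> pt"
  assumes w: "continuous_on UNIV w" and lt: "\<And>x. norm (w x) < vb"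
  shows "(\<lambda>z. fcost vb w (fst z) (snd z)) \<in> borel_measurable borel"
proof (rule borel_measurable_continuous_onI)
  have W: "continuous_on UNIV (\<lambda>z::pt\<times>pt. w (fst z))"
    by (rule continuous_on_compose2[OF w]) (auto intro: continuous_intros)
  have "vb\<^sup>2 - w x \<bullet> w x \<noteq> 0" for x
    using lt[of x] power_strict_mono[of "norm (w x)" vb 2] by (simp add: dot_square_norm)
  then show "continuous_on UNIV (\<lambda>z::pt\<times>pt. fcost vb w (fst z) (snd z))"
    unfolding fcost_def by (intro continuous_intros W) auto
qed

text \<open>For \<open>l > 0\<close> these are compact subsets of the region
  \<open>p \<noteq> 0\<close>, as the bounds on \<open>G\<close> and \<open>H\<close>
  require.\<close>

definition shell :: "real \<Rightarrow> real \<Rightarrow> (pt \<times> pt) set" where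
  "shell \<rho> l = cball 0 \<rho> \<times> (cball 0 \<rho> - ball 0 l)"

lemma mem_shell: "(x, p) \<in> shell \<rho> l \<longleftrightarrow> norm x \<le> \<rho> \<and> norm p \<le> \<rho> \<and> l \<le> norm p"
  by (auto simp: shell_def)

lemma compact_shell: "compact (shell \<rho> l)"
  unfolding shell_def by (intro compact_Times compact_diff) auto

lemma shell_subset: "l > 0 \<Longrightarrow> shell \<rho> l \<subseteq> {z. snd z \<noteq> 0}"
  by (auto simp: shell_def)

lemma T2_eq_integral:
  assumes ex: "second_order_expansion {z. snd z \<noteq> 0} (\<lambda>z. fcost vb w (fst z) (snd z)) G H"
    and meas: "(\<lambda>z. fcost vb w (fst z) (snd z)) \<in> borel_measurable borel"
    and W: "W1inf \<xi> \<xi>'" "W1inf d\<xi> d\<xi>'"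
    and l: "l > 0" "AE t in I01. l \<le> norm (\<xi>' t)"
  shows "T2 vb w \<xi> \<xi>' d\<xi> d\<xi>' = (LINT t|I01. H (\<xi> t, \<xi>' t) (d\<xi> t, d\<xi>' t) (d\<xi> t, d\<xi>' t))"
    and "integrable I01 (\<lambda>t. H (\<xi> t, \<xi>' t) (d\<xi> t, d\<xi>' t) (d\<xi> t, d\<xi>' t))"
proof -
  interpret second_order_expansion "{z. snd z \<noteq> 0}" "\<lambda>z. fcost vb w (fst z) (snd z)" G H by (rule ex)
  note S = W1inf_Linf_space[OF W(1)] W1inf_Linf_space[OF W(2)]
  obtain M1 where M1: "M1 \<ge> 0" "AE t in I01. norm (\<xi> t) \<le> M1" using Linf_spaceE[OF S(1)] by blast
  obtain M2 where M2: "M2 \<ge> 0" "AE t in I01. norm (\<xi>' t) \<le> M2" using Linf_spaceE[OF S(2)] by blast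
  obtain M3 where M3: "M3 \<ge> 0" "AE t in I01. norm (d\<xi> t) \<le> M3" using Linf_spaceE[OF S(3)] by blast
  obtain M4 where M4: "M4 \<ge> 0" "AE t in I01. norm (d\<xi>' t) \<le> M4" using Linf_spaceE[OF S(4)] by blast
  define M where "M = M1 + M2 + M3 + M4 + 1"
  have le: "M1 \<le> M" "M2 \<le> M" "M3 \<le> M" "M4 \<le> M" and M0: "M > 0"
    using M1(1) M2(1) M3(1) M4(1) unfolding M_def by linarith+
  have M: "M > 0" "AE t in I01. norm (\<xi> t) \<le> M" "AE t in I01. norm (\<xi>' t) \<le> M"
     "AE t in I01. norm (d\<xi> t) \<le> M" "AE t in I01. norm (d\<xi>' t) \<le> M"
    using M0 order_trans[OF _ le(1)] order_trans[OF _ le(2)] order_trans[OF _ le(3)] order_trans[OF _ le(4)]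
    by (auto intro: eventually_mono[OF M1(2)] eventually_mono[OF M2(2)] eventually_mono[OF M3(2)] eventually_mono[OF M4(2)])
  \<comment> \<open>\<open>\<bar>s\<bar> \<le> 1\<close> keeps all norms below \<open>2 * M\<close>,
    and \<open>\<bar>s\<bar> * M \<le> l / 2\<close> leaves at least half of the speed. The summand
    1 in \<open>M\<close> makes the quotient meaningful.\<close>
  define e where "e = min 1 (l / (2 * M))"
  have e: "e > 0" "e \<le> 1" "e * M \<le> l / 2" using l M(1) by (auto simp: e_def min_def field_simps)
  define K where "K = shell (2 * M) (l / 2)"
  have K: "compact K" "K \<subseteq> {z. snd z \<noteq> 0}"
    unfolding K_def using l by (auto intro: compact_shell dest: shell_subset[THEN subsetD, rotated])
  have mV: "(\<lambda>t. (\<xi> t, \<xi>' t)) \<in> borel_measurable I01" "(\<lambda>t. (d\<xi> t, d\<xi>' t)) \<in> borel_measurable I01"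
    by (intro borel_measurable_Pair Linf_space_measurable S)+
  have VK: "AE t in I01. \<forall>s\<in>{-e<..<e}. (\<xi> t, \<xi>' t) + s *\<^sub>R (d\<xi> t, d\<xi>' t) \<in> K"
    using M(2-5) l(2)
  proof eventually_elim
    case (elim t)
    show ?case
    proof
      fix s assume s: "s \<in> {-e<..<e}"
      then have s1: "\<bar>s\<bar> \<le> e" "\<bar>s\<bar> \<le> 1" using e by auto
      have a: "norm (s *\<^sub>R d\<xi> t) \<le> 1 * M" "norm (s *\<^sub>R d\<xi>' t) \<le> 1 * M"
        unfolding norm_scaleR using s1 elim by (intro mult_mono; simp)+
      have b: "norm (s *\<^sub>R d\<xi>' t) \<le> e * M"
        unfolding norm_scaleR using s1 elim e by (intro mult_mono) auto
      have "norm (\<xi>' t) \<le> norm (\<xi>' t + s *\<^sub>R d\<xi>' t) + norm (s *\<^sub>R d\<xi>' t)"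
        using norm_triangle_ineq4[of "\<xi>' t + s *\<^sub>R d\<xi>' t" "s *\<^sub>R d\<xi>' t"] by simp
      then have c: "l / 2 \<le> norm (\<xi>' t + s *\<^sub>R d\<xi>' t)" using b e(3) elim by linarith
      have "norm (\<xi> t + s *\<^sub>R d\<xi> t) \<le> 2 * M" "norm (\<xi>' t + s *\<^sub>R d\<xi>' t) \<le> 2 * M"
        using norm_triangle_ineq[of "\<xi> t" "s *\<^sub>R d\<xi> t"] norm_triangle_ineq[of "\<xi>' t" "s *\<^sub>R d\<xi>' t"] a elim by linarith+
      then show "(\<xi> t, \<xi>' t) + s *\<^sub>R (d\<xi> t, d\<xi>' t) \<in> K" using c by (simp add: K_def mem_shell)
    qed
  qed
  have dVC: "AE t in I01. norm (d\<xi> t, d\<xi>' t) \<le> 2 * M"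
    using M(4,5)
  proof eventually_elim
    case (elim t)
    then show ?case using norm_Pair_le[of "d\<xi> t" "d\<xi>' t"] by linarith
  qed
  have "deriv (deriv (\<lambda>s. LINT t|I01. fcost vb w (fst ((\<xi> t, \<xi>' t) + s *\<^sub>R (d\<xi> t, d\<xi>' t))) (snd ((\<xi> t, \<xi>' t) + s *\<^sub>R (d\<xi> t, d\<xi>' t))))) 0
      = (LINT t|I01. H (\<xi> t, \<xi>' t) (d\<xi> t, d\<xi>' t) (d\<xi> t, d\<xi>' t))"
    by (rule second_deriv_integral[OF I01.finite_measure_axioms mV meas K e(1) VK dVC])
  then show "T2 vb w \<xi> \<xi>' d\<xi> d\<xi>' = (LINT t|I01. H (\<xi> t, \<xi>' t) (d\<xi> t, d\<xi>' t) (d\<xi> t, d\<xi>' t))"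
    by (simp add: T2_def Tfun_def)
  obtain N where N: "N \<ge> 0" "\<And>z u v. z \<in> K \<Longrightarrow> \<bar>H z u v\<bar> \<le> N * norm u * norm v"
    using H_bound[OF K] by blast
  show "integrable I01 (\<lambda>t. H (\<xi> t, \<xi>' t) (d\<xi> t, d\<xi>' t) (d\<xi> t, d\<xi>' t))"
  proof (rule I01.integrable_const_bound[where B = "N * (2 * M) * (2 * M)"])
    show "AE t in I01. norm (H (\<xi> t, \<xi>' t) (d\<xi> t, d\<xi>' t) (d\<xi> t, d\<xi>' t)) \<le> N * (2 * M) * (2 * M)"
      using VK dVC
    proof eventually_elim
      case (elim t)
      have "(\<xi> t, \<xi>' t) \<in> K" using elim(1) e(1) by (auto dest: bspec[of _ _ 0])
      then have "norm (H (\<xi> t, \<xi>' t) (d\<xi> t, d\<xi>' t) (d\<xi> t, d\<xi>' t)) \<le> N * norm (d\<xi> t, d\<xi>' t) * norm (d\<xi> t, d\<xi>' t)"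
        using N(2) by simp
      also have "\<dots> \<le> N * (2 * M) * (2 * M)" using elim(2) N(1) M(1) by (intro mult_mono) auto
      finally show ?case .
    qed
  qed (rule measurable_along[OF mV])
qed

text \<open>The mixed terms are split by Young's inequality with weight \<open>R\<close>. In the
  application \<open>e\<close> is of order \<open>R\<close> relative to \<open>v\<close> in the L2
  sense, so the quotient by \<open>R\<close> is still of order \<open>R\<close>. The two mixed terms
  are estimated separately, as \<open>h\<close> need not be symmetric.\<close>

lemma bilinear_perturbation:
  fixes h :: "'a::real_normed_vector \<Rightarrow> 'a \<Rightarrow> real"
  assumes h: "bilinear h" and N: "N \<ge> 0" "\<And>u v. \<bar>h u v\<bar> \<le> N * norm u * norm v" and R: "R > 0"
  shows "h (v - e) (v - e) - N * (R * (norm v)\<^sup>2 + (norm e)\<^sup>2 / R + (norm e)\<^sup>2) \<le> h v v"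
proof -
  have eq: "h (v - e) (v - e) = h v v - h v e - h e v + h e e"
    by (simp add: bilinear_lsub[OF h] bilinear_rsub[OF h])
  have "0 \<le> (R * norm v - norm e)\<^sup>2 / R" using R by simp
  also have "\<dots> = R * (norm v)\<^sup>2 + (norm e)\<^sup>2 / R - 2 * (norm v * norm e)"
    using R by (simp add: power2_diff power_mult_distrib diff_divide_distrib add_divide_distrib power2_eq_square[of R])
  finally have "N * (2 * (norm v * norm e)) \<le> N * (R * (norm v)\<^sup>2 + (norm e)\<^sup>2 / R)"
    using N(1) by (intro mult_left_mono) auto
  then have "N * norm v * norm e + N * norm e * norm v \<le> N * (R * (norm v)\<^sup>2 + (norm e)\<^sup>2 / R)"
    by (simp add: algebra_simps)
  moreover have "\<bar>h e e\<bar> \<le> N * (norm e)\<^sup>2" using N(2)[of e e] by (simp add: power2_eq_square mult.assoc)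
  moreover have "N * (R * (norm v)\<^sup>2 + (norm e)\<^sup>2 / R + (norm e)\<^sup>2)
      = N * (R * (norm v)\<^sup>2 + (norm e)\<^sup>2 / R) + N * (norm e)\<^sup>2"
    by (rule distrib_left)
  ultimately show ?thesis
    unfolding eq using N(2)[of v e] N(2)[of e v] by linarith
qed

section \<open>Signs of the wind bounds and smallness conditions on the radius\<close>

lemma AE_lebesgue_on_bound_nonneg:
  fixes g :: "'a::euclidean_space \<Rightarrow> 'b::real_normed_vector"
  assumes AE: "AE x in lebesgue_on S. norm (g x) \<le> c" and S: "S \<in> sets lebesgue" and i: "interior S \<noteq> {}"
  shows "c \<ge> 0"
proof (rule ccontr)
  assume "\<not> c \<ge> 0"
  then have "\<not> norm (g x) \<le> c" for x using norm_ge_zero[of "g x"] by linarith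
  \<comment> \<open>A negative bound holds at no point, so it could hold almost everywhere only on a
    null set.\<close>
  then have "AE x in lebesgue_on S. False" using AE by simp
  then have "AE x in lebesgue. x \<notin> S" using S by (simp add: AE_restrict_space_iff)
  then have "S \<in> null_sets lebesgue" using S by (subst (asm) AE_iff_null_sets[symmetric]) auto
  then have "negligible S" by (simp add: negligible_iff_null_sets)
  then show False using i open_not_negligible[OF open_interior] negligible_subset[OF _ interior_subset] by blast
qed

lemma ellipse_sets_interior:
  fixes p q :: "'a::euclidean_space"
  assumes "2 * a > dist p q"
  shows "{x. dist x p + dist x q \<le> 2 * a} \<in> sets lebesgue" "interior {x. dist x p + dist x q \<le> 2 * a} \<noteq> {}"
proof -
  have "closed {x. dist x p + dist x q \<le> 2 * a}" by (intro closed_Collect_le continuous_intros)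
  then show "{x. dist x p + dist x q \<le> 2 * a} \<in> sets lebesgue" by auto
  have "open {x. dist x p + dist x q < 2 * a}" by (intro open_Collect_less continuous_intros)
  then have "{x. dist x p + dist x q < 2 * a} \<subseteq> interior {x. dist x p + dist x q \<le> 2 * a}"
    by (intro interior_maximal) auto
  moreover have "p \<in> {x. dist x p + dist x q < 2 * a}" using assms by simp
  ultimately show "interior {x. dist x p + dist x q \<le> 2 * a} \<noteq> {}" by blast
qed

text \<open>Multiplied out, the condition reads \<open>R * (2 * \<Gamma> R) < B\<close>, and its
  left-hand side tends to 0 because \<Gamma> is continuous near 0.\<close>

lemma eventually_less_Gamma_bar:
  assumes vb: "c0\<^sup>2 < vb\<^sup>2" and c1: "c1 \<ge> 0" and Lt: "Lt > 0" and B: "B > 0"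
  shows "eventually (\<lambda>R. R < B / (2 * Gamma_bar vb c0 c1 c2 c3 Lt R)) (at_right 0)"
proof -
  define vu where "vu = sqrt (vb\<^sup>2 - c0\<^sup>2)"
  have vu: "vu > 0" using vb by (simp add: vu_def)
  define g0 g1 g2 where "g0 = 2 / vu ^ 4 * (37 * c1 ^ 3 + 21 * c1 * c2 * vu + 2 * c3 * vu\<^sup>2)"
    and "g1 = (29 * c1\<^sup>2 + 7 * vu * c2) / vu ^ 3" and "g2 = (57 * c1\<^sup>2 + 13 * vu * c2) / vu ^ 3"
  define g3 g4 g5 where "g3 = 40 * c1 / vu\<^sup>2" and "g4 = 20 * c1 / vu\<^sup>2" and "g5 = 18 / vu"
  define \<Gamma> where "\<Gamma> R = max (((vb + c0) / (vb - c0) * Lt + R) * g0 + g2 / 2) (max (g4 / (Lt - R) + g2 / 2)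
      (max (g1 + g3 / (2 * (Lt - R))) (g3 / (2 * (Lt - R)) + g5 / (Lt - R)\<^sup>2)))" for R
  have \<Gamma>: "Gamma_bar vb c0 c1 c2 c3 Lt R = \<Gamma> R" for R
    unfolding Gamma_bar_def Let_def \<Gamma>_def g0_def g1_def g2_def g3_def g4_def g5_def vu_def by simp
  have "((\<lambda>R. R * (2 * \<Gamma> R)) \<longlongrightarrow> 0 * (2 * \<Gamma> 0)) (at_right 0)"
    unfolding \<Gamma>_def using Lt by (intro tendsto_intros) auto
  then have "eventually (\<lambda>R. R * (2 * \<Gamma> R) < B) (at_right 0)"
    using B by (intro order_tendstoD(2)[where y = 0]) auto
  moreover have "eventually (\<lambda>R. R < Lt) (at_right 0)"
    using Lt by (auto simp: eventually_at_right_field)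
  ultimately show ?thesis
  proof eventually_elim
    case (elim R)
    \<comment> \<open>Returning to the quotient requires \<Gamma> to be positive. The last entry of
      the maximum guarantees it: \<open>g5 > 0\<close> and \<open>g3 \<ge> 0\<close>.\<close>
    have "0 < g3 / (2 * (Lt - R)) + g5 / (Lt - R)\<^sup>2"
      using elim(2) c1 vu by (intro add_nonneg_pos) (auto simp: g3_def g5_def)
    also have "\<dots> \<le> \<Gamma> R" unfolding \<Gamma>_def by simp
    finally have "0 < 2 * \<Gamma> R" by simp
    then show ?case unfolding \<Gamma> using elim(1) by (simp add: pos_less_divide_eq)
  qed
qed

text \<open>Three losses are charged against the constant \<open>B\<close>: moving the base point of
  the quadratic form, correcting the direction, and the nonzero multiplier. The first is fixed at
  \<open>B / 4\<close> by uniform continuity, the other two vanish with \<open>R\<close>.\<close>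

lemma Lzz_coercive_nearby:
  fixes w :: "pt \<Rightarrow> pt"
  assumes ex: "second_order_expansion {z. snd z \<noteq> 0} (\<lambda>z. fcost vb w (fst z) (snd z)) G H"
    and meas: "(\<lambda>z. fcost vb w (fst z) (snd z)) \<in> borel_measurable borel"
    and OD: "xO \<noteq> xD"
    and feas: "feasible vb w xO xD Lst \<xi>st \<xi>st'"
    and lam0: "Linf_space lamst" "ae01 (\<lambda>t. lamst t = 0)"
    and B: "B > 0"
    and SOSC: "\<forall>dL d\<xi> d\<xi>'. (dL, d\<xi>, d\<xi>') \<in> dZset \<and> ae01 (\<lambda>t. d\<xi>' t \<bullet> \<xi>st' t = dL * Lst) \<longrightarrow>
        T2 vb w \<xi>st \<xi>st' d\<xi> d\<xi>' \<ge> B * (Z2norm dL d\<xi> d\<xi>')\<^sup>2"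
  shows "eventually (\<lambda>R. \<forall>L \<xi> \<xi>' lam. inX xO xD \<xi> \<xi>' \<and> Linf_space lam \<and>
              \<bar>L - Lst\<bar> + Linf (\<lambda>t. \<xi> t - \<xi>st t) + Linf (\<lambda>t. \<xi>' t - \<xi>st' t)
                + Linf (\<lambda>t. lam t - lamst t) \<le> R \<longrightarrow>
              (\<forall>dL d\<xi> d\<xi>'. (dL, d\<xi>, d\<xi>') \<in> dZset \<and> ae01 (\<lambda>t. \<xi>' t \<bullet> d\<xi>' t = L * dL) \<longrightarrow>
                 Lzz vb w L \<xi> \<xi>' lam dL d\<xi> d\<xi>' \<ge> B / 4 * (Z2norm dL d\<xi> d\<xi>')\<^sup>2)) (at_right 0)"
proof -
  interpret second_order_expansion "{z. snd z \<noteq> 0}" "\<lambda>z. fcost vb w (fst z) (snd z)" G H by (rule ex)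
  have Wst: "W1inf \<xi>st \<xi>st'" and ends: "\<xi>st 0 = xO" "\<xi>st 1 = xD" and sp: "AE t in I01. (norm (\<xi>st' t))\<^sup>2 = Lst\<^sup>2"
    using feas by (auto simp: feasible_def inX_def ae01_def)
  note Sst = W1inf_Linf_space[OF Wst]
  define l where "l = \<bar>Lst\<bar>"
  have spn: "AE t in I01. norm (\<xi>st' t) = l"
    using sp unfolding l_def by eventually_elim (metis real_sqrt_abs abs_norm_cancel)
  have "l \<noteq> 0"
  proof
    assume "l = 0"
    then have "AE t in I01. \<xi>st' t = 0" using spn by simp
    then have "(LINT t|I01. \<xi>st' t) = 0" by (rule integral_eq_zero_AE)
    then show False using OD W1inf_integral[OF Wst] ends by simp
  qed
  then have l: "l > 0" by (simp add: l_def)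
  obtain M where M: "M \<ge> 0" "AE t in I01. norm (\<xi>st t) \<le> M" using Linf_spaceE[OF Sst(1)] by blast
  \<comment> \<open>Large enough for the optimal curve and for every curve within distance
    \<open>R < min 1 (l / 2)\<close> of it.\<close>
  define K where "K = shell (M + l + 1) (l / 2)"
  have K: "compact K" "K \<subseteq> {z. snd z \<noteq> 0}"
    unfolding K_def using l by (auto intro: compact_shell dest: shell_subset[THEN subsetD, rotated])
  obtain N where N: "N \<ge> 0" "\<And>z u v. z \<in> K \<Longrightarrow> \<bar>H z u v\<bar> \<le> N * norm u * norm v"
    using H_bound[OF K] by blast
  obtain \<delta> where \<delta>: "\<delta> > 0" "\<And>z y u v. z \<in> K \<Longrightarrow> y \<in> K \<Longrightarrow> dist z y < \<delta> \<Longrightarrow> \<bar>H z u v - H y u v\<bar> \<le> B / 4 * norm u * norm v"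
    using H_uniformly_continuous[OF K, of "B / 4"] B by auto
  obtain C where C: "C \<ge> 0" "\<And>r. Linf_space r \<Longrightarrow> \<exists>m \<eta> \<eta>'. (m, \<eta>, \<eta>') \<in> dZset \<and>
      (AE t in I01. \<xi>st' t \<bullet> \<eta>' t = r t + Lst * m) \<and> Z2norm m \<eta> \<eta>' \<le> C * L2norm r"
    using constraint_right_inverse[OF Wst _ sp] OD ends by auto
  \<comment> \<open>The factor \<open>(1 - C * R)^2\<close> comes from the shortened direction, the
    \<open>N\<close> term from perturbing the form, \<open>2 * R\<close> from the multiplier. The
    limit is \<open>B\<close>, so \<open>B / 2\<close> remains eventually; subtracting
    \<open>B / 4\<close> for the change of base point leaves \<open>B / 4\<close>.\<close>
  have "((\<lambda>R. B * (1 - C * R)\<^sup>2 - N * (R + C\<^sup>2 * R + (C * R)\<^sup>2) - 2 * R) \<longlongrightarrow>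
      B * (1 - C * 0)\<^sup>2 - N * (0 + C\<^sup>2 * 0 + (C * 0)\<^sup>2) - 2 * 0) (at_right 0)"
    by (intro tendsto_intros)
  then have "eventually (\<lambda>R. B / 2 < B * (1 - C * R)\<^sup>2 - N * (R + C\<^sup>2 * R + (C * R)\<^sup>2) - 2 * R) (at_right 0)"
    using B by (intro order_tendstoD(1)[where y = B]) auto
  moreover have "((\<lambda>R. C * R) \<longlongrightarrow> C * 0) (at_right 0)" by (intro tendsto_intros)
  then have "eventually (\<lambda>R. C * R < 1) (at_right 0)" by (intro order_tendstoD(2)[where y = 0]) auto
  moreover have "eventually (\<lambda>R. 0 < R \<and> R < min (min 1 (l / 2)) \<delta>) (at_right (0::real))"
    using l \<delta>(1) by (intro eventually_at_right_real[unfolded greaterThanLessThan_iff]) auto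
  ultimately show ?thesis
  proof eventually_elim
    case (elim R)
    have R: "R > 0" "R < 1" "R < l / 2" "R < \<delta>" "C * R < 1" and
      RB: "B / 2 < B * (1 - C * R)\<^sup>2 - N * (R + C\<^sup>2 * R + (C * R)\<^sup>2) - 2 * R"
      using elim by auto
    show ?case
    proof (intro allI impI, elim conjE)
      fix L \<xi> \<xi>' lam dL d\<xi> d\<xi>'
      assume X: "inX xO xD \<xi> \<xi>'" and lam: "Linf_space lam"
        and near: "\<bar>L - Lst\<bar> + Linf (\<lambda>t. \<xi> t - \<xi>st t) + Linf (\<lambda>t. \<xi>' t - \<xi>st' t) + Linf (\<lambda>t. lam t - lamst t) \<le> R"
        and dz: "(dL, d\<xi>, d\<xi>') \<in> dZset" and con: "ae01 (\<lambda>t. \<xi>' t \<bullet> d\<xi>' t = L * dL)"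
      have W: "W1inf \<xi> \<xi>'" using X by (simp add: inX_def)
      have dW: "W1inf d\<xi> d\<xi>'" "d\<xi> 0 = 0" "d\<xi> 1 = 0" using dz by (auto simp: dZset_def)
      note S = W1inf_Linf_space[OF W] and dS = W1inf_Linf_space[OF dW(1)]
      define Z where "Z = Z2norm dL d\<xi> d\<xi>'"
      have Z0: "Z \<ge> 0" by (simp add: Z_def Z2norm_nonneg)
      have D: "Linf_space (\<lambda>t. \<xi> t - \<xi>st t)" "Linf_space (\<lambda>t. \<xi>' t - \<xi>st' t)" "Linf_space (\<lambda>t. lam t - lamst t)"
        by (intro Linf_space_diff S Sst lam lam0)+
      note D0 = D[THEN Linf_nonneg] and Dle = D(1)[THEN AE_norm_le_Linf] D(2)[THEN AE_norm_le_Linf] D(3)[THEN AE_norm_le_Linf]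
      have Lle: "\<bar>L - Lst\<bar> \<le> R" using near D0 by linarith
      have \<xi>'le: "AE t in I01. norm (\<xi>' t - \<xi>st' t) \<le> R"
        using Dle(2) by eventually_elim (use near D0 in linarith)
      have lamle: "AE t in I01. \<bar>lam t\<bar> \<le> R"
        using Dle(3) lam0(2)[unfolded ae01_def] by eventually_elim (use near D0 in simp)
      have dist: "AE t in I01. dist (\<xi> t, \<xi>' t) (\<xi>st t, \<xi>st' t) < \<delta>"
        using Dle(1,2)
      proof eventually_elim
        case (elim t)
        then show ?case
          using near D0 R norm_Pair_le[of "\<xi> t - \<xi>st t" "\<xi>' t - \<xi>st' t"] by (simp add: dist_norm)
      qed
      have VK: "AE t in I01. (\<xi> t, \<xi>' t) \<in> K" "AE t in I01. (\<xi>st t, \<xi>st' t) \<in> K"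
      proof -
        show "AE t in I01. (\<xi>st t, \<xi>st' t) \<in> K"
          using spn M(2) by eventually_elim (use l M(1) in \<open>simp add: K_def mem_shell\<close>)
        show "AE t in I01. (\<xi> t, \<xi>' t) \<in> K"
          using Dle(1) \<xi>'le spn M(2)
        proof eventually_elim
          case (elim t)
          have "norm (\<xi> t) \<le> M + 1"
            using norm_triangle_ineq[of "\<xi> t - \<xi>st t" "\<xi>st t"] elim near D0 R by simp
          moreover have "norm (\<xi>' t) \<le> l + 1"
            using norm_triangle_ineq[of "\<xi>' t - \<xi>st' t" "\<xi>st' t"] elim R by simp
          moreover have "l / 2 \<le> norm (\<xi>' t)"
            using norm_triangle_ineq4[of "\<xi>' t" "\<xi>' t - \<xi>st' t"] elim R by simp
          ultimately show ?case using l M(1) by (simp add: K_def mem_shell)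
        qed
      qed
      define r where "r t = \<xi>st' t \<bullet> d\<xi>' t - Lst * dL" for t
      have Lr: "Linf_space r" unfolding r_def by (intro Linf_space_diff Linf_space_inner Sst dS Linf_space_const)
      have "AE t in I01. norm (r t) \<le> R * norm (d\<xi>' t) + R * \<bar>dL\<bar>"
        using con[unfolded ae01_def] \<xi>'le
      proof eventually_elim
        case (elim t)
        \<comment> \<open>Subtracting the tangency relation at the nearby point leaves only
          differences of base points, each at most \<open>R\<close>.\<close>
        have "r t = (L - Lst) * dL - (\<xi>' t - \<xi>st' t) \<bullet> d\<xi>' t"
          using elim(1) by (simp add: r_def algebra_simps inner_diff_left)
        also have "norm \<dots> \<le> \<bar>(L - Lst) * dL\<bar> + \<bar>(\<xi>' t - \<xi>st' t) \<bullet> d\<xi>' t\<bar>"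
          by simp
        finally have "norm (r t) \<le> \<bar>(L - Lst) * dL\<bar> + \<bar>(\<xi>' t - \<xi>st' t) \<bullet> d\<xi>' t\<bar>" .
        moreover have "\<bar>(L - Lst) * dL\<bar> \<le> R * \<bar>dL\<bar>"
          unfolding abs_mult by (intro mult_right_mono Lle) simp
        moreover have "\<bar>(\<xi>' t - \<xi>st' t) \<bullet> d\<xi>' t\<bar> \<le> R * norm (d\<xi>' t)"
          by (rule order_trans[OF Cauchy_Schwarz_ineq2 mult_right_mono[OF elim(2)]]) simp
        ultimately show ?case by linarith
      qed
      then have "L2norm r \<le> R * L2norm d\<xi>' + R * \<bar>dL\<bar>"
        using R by (intro L2norm_le_affine Lr dS) auto
      also have "\<dots> \<le> R * Z"
        using R L2norm_nonneg[of d\<xi>] by (simp add: Z_def Z2norm_def distrib_left)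
      finally have rle: "L2norm r \<le> R * Z" .
      obtain m \<eta> \<eta>' where \<eta>: "(m, \<eta>, \<eta>') \<in> dZset" "AE t in I01. \<xi>st' t \<bullet> \<eta>' t = r t + Lst * m" "Z2norm m \<eta> \<eta>' \<le> C * L2norm r"
        using C(2)[OF Lr] by blast
      have W\<eta>: "W1inf \<eta> \<eta>'" "\<eta> 0 = 0" "\<eta> 1 = 0" using \<eta>(1) by (auto simp: dZset_def)
      note \<eta>S = W1inf_Linf_space[OF W\<eta>(1)]
      have E: "Z2norm m \<eta> \<eta>' \<le> C * R * Z"
        using \<eta>(3) mult_left_mono[OF rle C(1)] by (simp add: mult.assoc)
      have dW': "W1inf (\<lambda>t. d\<xi> t - \<eta> t) (\<lambda>t. d\<xi>' t - \<eta>' t)" by (rule W1inf_diff[OF dW(1) W\<eta>(1)])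
      have "(dL - m, \<lambda>t. d\<xi> t - \<eta> t, \<lambda>t. d\<xi>' t - \<eta>' t) \<in> dZset"
        using dW' dW W\<eta> by (simp add: dZset_def)
      moreover have "ae01 (\<lambda>t. (d\<xi>' t - \<eta>' t) \<bullet> \<xi>st' t = (dL - m) * Lst)"
        unfolding ae01_def using \<eta>(2)
        by eventually_elim (simp add: r_def inner_diff_left inner_commute algebra_simps)
      ultimately have "T2 vb w \<xi>st \<xi>st' (\<lambda>t. d\<xi> t - \<eta> t) (\<lambda>t. d\<xi>' t - \<eta>' t)
          \<ge> B * (Z2norm (dL - m) (\<lambda>t. d\<xi> t - \<eta> t) (\<lambda>t. d\<xi>' t - \<eta>' t))\<^sup>2"
        using SOSC by blast
      \<comment> \<open>The correction has norm at most \<open>C * R * Z\<close>, so the corrected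
        direction keeps the fraction \<open>1 - C * R\<close>. As \<open>C * R < 1\<close>, the
        bound may be squared.\<close>
      moreover have "(1 - C * R) * Z \<le> Z2norm (dL - m) (\<lambda>t. d\<xi> t - \<eta> t) (\<lambda>t. d\<xi>' t - \<eta>' t)"
        using Z2norm_triangle[OF dz \<eta>(1)] E by (simp add: Z_def left_diff_distrib)
      then have "((1 - C * R) * Z)\<^sup>2 \<le> (Z2norm (dL - m) (\<lambda>t. d\<xi> t - \<eta> t) (\<lambda>t. d\<xi>' t - \<eta>' t))\<^sup>2"
        using R Z0 by (intro power_mono) auto
      then have "B * ((1 - C * R) * Z)\<^sup>2 \<le> B * (Z2norm (dL - m) (\<lambda>t. d\<xi> t - \<eta> t) (\<lambda>t. d\<xi>' t - \<eta>' t))\<^sup>2"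
        using B by (intro mult_left_mono) auto
      ultimately have Tst: "T2 vb w \<xi>st \<xi>st' (\<lambda>t. d\<xi> t - \<eta> t) (\<lambda>t. d\<xi>' t - \<eta>' t) \<ge> B * (1 - C * R)\<^sup>2 * Z\<^sup>2"
        by (simp add: power_mult_distrib mult.assoc)
      define V where "V t = (\<xi> t, \<xi>' t)" for t
      define Vst where "Vst t = (\<xi>st t, \<xi>st' t)" for t
      define dV where "dV t = (d\<xi> t, d\<xi>' t)" for t
      define e where "e t = (\<eta> t, \<eta>' t)" for t
      have lst: "AE t in I01. l \<le> norm (\<xi>st' t)" using spn by eventually_elim simp
      \<comment> \<open>The nearby curve need not have constant speed; only this lower bound
        survives, which is why \<open>T2_eq_integral\<close> asks for no more.\<close>
      have lxi: "AE t in I01. l / 2 \<le> norm (\<xi>' t)" using VK(1) by eventually_elim (simp add: K_def mem_shell)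
      note T2st = T2_eq_integral[OF ex meas Wst dW' l lst]
      have l2: "l / 2 > 0" using l by simp
      note T2x = T2_eq_integral[OF ex meas W dW(1) l2 lxi]
      have T2st: "T2 vb w \<xi>st \<xi>st' (\<lambda>t. d\<xi> t - \<eta> t) (\<lambda>t. d\<xi>' t - \<eta>' t) = (LINT t|I01. H (Vst t) (dV t - e t) (dV t - e t))"
          "integrable I01 (\<lambda>t. H (Vst t) (dV t - e t) (dV t - e t))"
        using T2st by (simp_all add: Vst_def dV_def e_def)
      have T2x: "T2 vb w \<xi> \<xi>' d\<xi> d\<xi>' = (LINT t|I01. H (V t) (dV t) (dV t))" "integrable I01 (\<lambda>t. H (V t) (dV t) (dV t))"
        using T2x by (simp_all add: V_def dV_def)
      have idV: "integrable I01 (\<lambda>t. (norm (dV t))\<^sup>2)" and ie: "integrable I01 (\<lambda>t. (norm (e t))\<^sup>2)"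
        using dS[THEN Linf_space_integrable_power2] \<eta>S[THEN Linf_space_integrable_power2]
        by (auto simp: dV_def e_def norm_Pair)
      define X Y where "X = (LINT t|I01. (norm (dV t))\<^sup>2)" and "Y = (LINT t|I01. (norm (e t))\<^sup>2)"
      \<comment> \<open>\<open>dL\<^sup>2\<close> is kept because the multiplier term contains it as
        well.\<close>
      have XZ: "X + dL\<^sup>2 \<le> Z\<^sup>2" using integral_norm_power2_le_Z2norm[OF dz] by (simp add: X_def dV_def Z_def)
      have "Y + m\<^sup>2 \<le> (Z2norm m \<eta> \<eta>')\<^sup>2" using integral_norm_power2_le_Z2norm[OF \<eta>(1)] by (simp add: Y_def e_def)
      also have "\<dots> \<le> (C * R * Z)\<^sup>2" by (intro power_mono E Z2norm_nonneg)
      finally have YZ: "Y \<le> (C * R)\<^sup>2 * Z\<^sup>2" using zero_le_power2[of m] unfolding power_mult_distrib[of "C * R"] by linarith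
      have "AE t in I01. H (Vst t) (dV t - e t) (dV t - e t) - N * (R * (norm (dV t))\<^sup>2 + (norm (e t))\<^sup>2 / R + (norm (e t))\<^sup>2)
          - B / 4 * (norm (dV t))\<^sup>2 \<le> H (V t) (dV t) (dV t)"
        using VK dist
      proof eventually_elim
        case (elim t)
        have VKt: "V t \<in> K" "Vst t \<in> K" "dist (V t) (Vst t) < \<delta>" using elim by (auto simp: V_def Vst_def)
        have "H (Vst t) (dV t - e t) (dV t - e t) - N * (R * (norm (dV t))\<^sup>2 + (norm (e t))\<^sup>2 / R + (norm (e t))\<^sup>2)
            \<le> H (Vst t) (dV t) (dV t)"
          by (rule bilinear_perturbation[OF H_bilinear N(1) N(2)[OF VKt(2)] R(1)])
        moreover have "\<bar>H (V t) (dV t) (dV t) - H (Vst t) (dV t) (dV t)\<bar> \<le> B / 4 * (norm (dV t))\<^sup>2"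
          using \<delta>(2)[OF VKt, of "dV t" "dV t"] by (simp add: power2_eq_square mult.assoc)
        ultimately show ?case by linarith
      qed
      then have "(LINT t|I01. H (Vst t) (dV t - e t) (dV t - e t) - N * (R * (norm (dV t))\<^sup>2 + (norm (e t))\<^sup>2 / R + (norm (e t))\<^sup>2)
          - B / 4 * (norm (dV t))\<^sup>2) \<le> (LINT t|I01. H (V t) (dV t) (dV t))"
        using idV ie T2st(2) T2x(2) by (intro integral_mono_AE) auto
      also have "(LINT t|I01. H (Vst t) (dV t - e t) (dV t - e t) - N * (R * (norm (dV t))\<^sup>2 + (norm (e t))\<^sup>2 / R + (norm (e t))\<^sup>2)
          - B / 4 * (norm (dV t))\<^sup>2) = (LINT t|I01. H (Vst t) (dV t - e t) (dV t - e t)) - N * (R * X + Y / R + Y) - B / 4 * X"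
        using idV ie T2st(2) by (simp add: X_def Y_def)
      finally have T1: "T2 vb w \<xi> \<xi>' d\<xi> d\<xi>' \<ge> B * (1 - C * R)\<^sup>2 * Z\<^sup>2 - N * (R * X + Y / R + Y) - B / 4 * X"
        using Tst unfolding T2st(1) T2x(1) by linarith
      have XZ': "X \<le> Z\<^sup>2" using XZ zero_le_power2[of dL] by linarith
      \<comment> \<open>\<open>Y\<close> is of order \<open>R^2\<close>, so even after division by
        \<open>R\<close> the correction costs only a multiple of
        \<open>R * Z\<^sup>2\<close>.\<close>
      have "R * X + Y / R + Y \<le> R * Z\<^sup>2 + ((C * R)\<^sup>2 * Z\<^sup>2) / R + (C * R)\<^sup>2 * Z\<^sup>2"
        using R XZ' YZ by (intro add_mono mult_left_mono divide_right_mono) auto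
      also have "\<dots> = (R + C\<^sup>2 * R + (C * R)\<^sup>2) * Z\<^sup>2"
        using R by (simp add: distrib_right power_mult_distrib power2_eq_square[of R])
      finally have "N * (R * X + Y / R + Y) \<le> N * ((R + C\<^sup>2 * R + (C * R)\<^sup>2) * Z\<^sup>2)"
        using N(1) by (rule mult_left_mono)
      moreover have "B / 4 * X \<le> B / 4 * Z\<^sup>2" using B XZ' by (intro mult_left_mono) auto
      ultimately have T3: "T2 vb w \<xi> \<xi>' d\<xi> d\<xi>' \<ge> B * (1 - C * R)\<^sup>2 * Z\<^sup>2 - N * ((R + C\<^sup>2 * R + (C * R)\<^sup>2) * Z\<^sup>2) - B / 4 * Z\<^sup>2"
        using T1 by linarith
      have Lin: "Linf_space (\<lambda>t. lam t * (d\<xi>' t \<bullet> d\<xi>' t - dL\<^sup>2))"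
        using Linf_space_scaleR[OF lam Linf_space_diff[OF Linf_space_inner[OF dS(2) dS(2)] Linf_space_const[of "dL\<^sup>2"]]] by simp
      have "AE t in I01. - (R * ((norm (dV t))\<^sup>2 + dL\<^sup>2)) \<le> lam t * (d\<xi>' t \<bullet> d\<xi>' t - dL\<^sup>2)"
        using lamle
      \<comment> \<open>\<open>lamst\<close> vanishes, so \<open>lam\<close> itself is bounded by
        \<open>R\<close>. This term therefore costs at most \<open>R * Z\<^sup>2\<close>, doubled by
        the factor 2 in \<open>Lzz\<close>.\<close>
      proof eventually_elim
        case (elim t)
        have "\<bar>d\<xi>' t \<bullet> d\<xi>' t - dL\<^sup>2\<bar> \<le> (norm (dV t))\<^sup>2 + dL\<^sup>2"
          by (simp add: dV_def norm_Pair dot_square_norm abs_le_iff)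
        then have "\<bar>lam t * (d\<xi>' t \<bullet> d\<xi>' t - dL\<^sup>2)\<bar> \<le> R * ((norm (dV t))\<^sup>2 + dL\<^sup>2)"
          unfolding abs_mult using elim R by (intro mult_mono) auto
        then show ?case by linarith
      qed
      then have "(LINT t|I01. - (R * ((norm (dV t))\<^sup>2 + dL\<^sup>2))) \<le> (LINT t|I01. lam t * (d\<xi>' t \<bullet> d\<xi>' t - dL\<^sup>2))"
        using idV Linf_space_integrable[OF Lin] by (intro integral_mono_AE) auto
      also have "(LINT t|I01. - (R * ((norm (dV t))\<^sup>2 + dL\<^sup>2))) = - (R * (X + (LINT t|I01. dL\<^sup>2)))"
        using idV by (simp add: X_def)
      also have "(LINT t|I01. dL\<^sup>2) = dL\<^sup>2" by (rule integral_const_I01)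
      finally have "- (R * (X + dL\<^sup>2)) \<le> (LINT t|I01. lam t * (d\<xi>' t \<bullet> d\<xi>' t - dL\<^sup>2))" .
      moreover have "R * (X + dL\<^sup>2) \<le> R * Z\<^sup>2" using R XZ by (intro mult_left_mono) auto
      ultimately have T4: "- (R * Z\<^sup>2) \<le> (LINT t|I01. lam t * (d\<xi>' t \<bullet> d\<xi>' t - dL\<^sup>2))" by linarith
      have "B / 2 * Z\<^sup>2 \<le> (B * (1 - C * R)\<^sup>2 - N * (R + C\<^sup>2 * R + (C * R)\<^sup>2) - 2 * R) * Z\<^sup>2"
        using RB by (intro mult_right_mono) auto
      also have "\<dots> = B * (1 - C * R)\<^sup>2 * Z\<^sup>2 - N * ((R + C\<^sup>2 * R + (C * R)\<^sup>2) * Z\<^sup>2) - 2 * (R * Z\<^sup>2)"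
        by (simp only: left_diff_distrib mult.assoc)
      finally show "Lzz vb w L \<xi> \<xi>' lam dL d\<xi> d\<xi>' \<ge> B / 4 * (Z2norm dL d\<xi> d\<xi>')\<^sup>2"
        using T3 T4 unfolding Lzz_def Z_def[symmetric] by linarith
    qed
  qed
qed

theorem theorem11:
  fixes vb c0 c1 c2 c3 B Lst :: real
    and xO xD :: pt
    and w :: "pt \<Rightarrow> pt"
    and Dw :: "pt \<Rightarrow> pt \<Rightarrow>\<^sub>L pt"
    and D2w :: "pt \<Rightarrow> pt \<Rightarrow>\<^sub>L (pt \<Rightarrow>\<^sub>L pt)"
    and D3w :: "pt \<Rightarrow> pt \<Rightarrow>\<^sub>L (pt \<Rightarrow>\<^sub>L (pt \<Rightarrow>\<^sub>L pt))"
    and \<Omega> :: "pt set"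
    and \<xi>st \<xi>st' :: "real \<Rightarrow> pt"
    and lamst :: "real \<Rightarrow> real"
  assumes vb: "vb > 0" and OD: "xO \<noteq> xD"
    and w_C3: "\<And>x. (w has_derivative blinfun_apply (Dw x)) (at x)"
              "\<And>x. (Dw has_derivative blinfun_apply (D2w x)) (at x)"
              "\<And>x. (D2w has_derivative blinfun_apply (D3w x)) (at x)"
              "continuous_on UNIV D3w"
    and w_lt: "\<And>x. norm (w x) < vb"
    and ellipse: "\<exists>a. 2 * a > dist xO xD \<and> \<Omega> = {x. dist x xO + dist x xD \<le> 2 * a}"
    and \<Omega>_contains: "\<And>L \<xi> \<xi>'. glob_opt vb w xO xD L \<xi> \<xi>' \<Longrightarrow> \<forall>t\<in>{0..1}. \<xi> t \<in> \<Omega>"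
    and c0: "AE x in lebesgue_on \<Omega>. norm (w x) \<le> c0" "c0 < vb / sqrt 5"
    and c1: "AE x in lebesgue_on \<Omega>. norm (Dw x) \<le> c1"
    and c2: "AE x in lebesgue_on \<Omega>. norm (D2w x) \<le> c2"
    and c3: "AE x in lebesgue_on \<Omega>. norm (D3w x) \<le> c3"
    and opt: "glob_opt vb w xO xD Lst \<xi>st \<xi>st'"
    and lam0: "Linf_space lamst" "ae01 (\<lambda>t. lamst t = 0)"
    and FOC: "first_order vb w Lst \<xi>st \<xi>st' lamst"
    and SOSC: "SOSC vb w Lst \<xi>st \<xi>st' B" and B: "B > 0"
  shows "\<exists>R>0. R < min (B / (2 * Gamma_bar vb c0 c1 c2 c3 (norm (xD - xO)) R))
                       (min (B / 40) (norm (xD - xO) / 2)) \<and>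
           (\<forall>L \<xi> \<xi>' lam. inX xO xD \<xi> \<xi>' \<and> Linf_space lam \<and>
              \<bar>L - Lst\<bar> + Linf (\<lambda>t. \<xi> t - \<xi>st t) + Linf (\<lambda>t. \<xi>' t - \<xi>st' t)
                + Linf (\<lambda>t. lam t - lamst t) \<le> R \<longrightarrow>
              (\<forall>dL d\<xi> d\<xi>'. (dL, d\<xi>, d\<xi>') \<in> dZset \<and> ae01 (\<lambda>t. \<xi>' t \<bullet> d\<xi>' t = L * dL) \<longrightarrow>
                 Lzz vb w L \<xi> \<xi>' lam dL d\<xi> d\<xi>' \<ge> B / 4 * (Z2norm dL d\<xi> d\<xi>')\<^sup>2))"
proof -
  have w_cont: "continuous_on UNIV w"
    by (rule has_derivative_continuous_on) (rule w_C3(1))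
  have D2w_cont: "continuous_on UNIV D2w"
    by (rule has_derivative_continuous_on) (rule w_C3(3))
  have U: "open {z::pt\<times>pt. snd z \<noteq> 0}"
    by (intro open_Collect_neq continuous_intros)
  obtain G H where ex: "second_order_expansion {z. snd z \<noteq> 0} (\<lambda>z. fcost vb w (fst z) (snd z)) G H"
    using C2_on_second_order_expansion[OF fcost_C2_on[OF w_C3(1,2) D2w_cont w_lt] U] by blast
  have feas: "feasible vb w xO xD Lst \<xi>st \<xi>st'" using opt by (simp add: glob_opt_def)
  note so = SOSC[unfolded SOSC_def, THEN conjunct2]
  obtain a where a: "2 * a > dist xO xD" "\<Omega> = {x. dist x xO + dist x xD \<le> 2 * a}"
    using ellipse by blast
  note \<Omega> = ellipse_sets_interior[OF a(1), folded a(2)]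
  \<comment> \<open>The comparison of \<open>c0\<close> with \<open>vb\<close> can be squared only
    for nonnegative \<open>c0\<close>. The sign follows from the almost everywhere bound, as the
    ellipse has interior points.\<close>
  have c0_nonneg: "c0 \<ge> 0" by (rule AE_lebesgue_on_bound_nonneg[OF c0(1) \<Omega>])
  have c1_nonneg: "c1 \<ge> 0" by (rule AE_lebesgue_on_bound_nonneg[OF c1 \<Omega>])
  have "vb / sqrt 5 \<le> vb" using vb by (simp add: divide_le_eq)
  then have "c0\<^sup>2 < vb\<^sup>2" using c0(2) c0_nonneg by (intro power_strict_mono) auto
  then have "eventually (\<lambda>R. R < B / (2 * Gamma_bar vb c0 c1 c2 c3 (norm (xD - xO)) R)) (at_right 0)"
    using c1_nonneg OD B by (intro eventually_less_Gamma_bar) auto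
  moreover have "eventually (\<lambda>R. 0 < R \<and> R < min (B / 40) (norm (xD - xO) / 2)) (at_right 0)"
    using B OD by (intro eventually_at_right_real[unfolded greaterThanLessThan_iff]) auto
  moreover note Lzz_coercive_nearby[OF ex fcost_measurable[OF w_cont w_lt] OD feas lam0 B so]
  ultimately have "eventually (\<lambda>R. 0 < R \<and> R < min (B / (2 * Gamma_bar vb c0 c1 c2 c3 (norm (xD - xO)) R))
                       (min (B / 40) (norm (xD - xO) / 2)) \<and>
           (\<forall>L \<xi> \<xi>' lam. inX xO xD \<xi> \<xi>' \<and> Linf_space lam \<and>
              \<bar>L - Lst\<bar> + Linf (\<lambda>t. \<xi> t - \<xi>st t) + Linf (\<lambda>t. \<xi>' t - \<xi>st' t)
                + Linf (\<lambda>t. lam t - lamst t) \<le> R \<longrightarrow>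
              (\<forall>dL d\<xi> d\<xi>'. (dL, d\<xi>, d\<xi>') \<in> dZset \<and> ae01 (\<lambda>t. \<xi>' t \<bullet> d\<xi>' t = L * dL) \<longrightarrow>
                 Lzz vb w L \<xi> \<xi>' lam dL d\<xi> d\<xi>' \<ge> B / 4 * (Z2norm dL d\<xi> d\<xi>')\<^sup>2))) (at_right 0)"
    by eventually_elim (simp only: min_less_iff_conj simp_thms)
  then show ?thesis
    using eventually_happens'[OF trivial_limit_at_right_real] by blast
qed

end
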